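(* Let $\varphi:\mathcal{L}_0\to\mathbb{C}$ be a linear map. The Verma module $\bar V(\varphi)$ over the loop-Virasoro algebra $\mathcal{L}=\mathrm{Vir}\otimes\mathbb{C}[t^{\pm1}]$ is not irreducible if and only if there exists a polynomial $P(t)\in\mathbb{C}[t]$ with nonzero constant term such that $$\varphi(d_0\otimes t^kP(t))=0\qquad\text{for all }k\in\mathbb{Z}.$$
   Context: The Virasoro algebra $\mathrm{Vir}$ is the complex Lie algebra with basis $\{c,d_i : i\in\mathbb{Z}\}$ and brackets $[d_m,d_n]=(n-m)d_{m+n}+\delta_{m,-n}\frac{m^3-m}{12}c$, $[d_m,c]=0$. The loop-Virasoro algebra is $\mathcal{L}=\mathrm{Vir}\otimes\mathbb{C}[t^{\pm1}]$ with brackets $[d_i\otimes t^j,d_k\otimes t^l]=(k-i)\,d_{i+k}\otimes t^{j+l}+\delta_{i+k,0}\frac{i^3-i}{12}\,c\otimes t^{j+l}$, and with $c\otimes t^l$ central. Let $\mathcal{L}_i=(\mathbb{C}d_i\oplus\delta_{i,0}\mathbb{C}c)\otimes\mathbb{C}[t^{\pm1}]$ and $\mathcal{L}_+=\bigoplus_{i>0}\mathcal{L}_i$. For a linear map $\varphi:\mathcal{L}_0\to\mathbb{C}$, let $\mathbb{C}v_0$ be the one-dimensional $(\mathcal{L}_0+\mathcal{L}_+)$-module with $\mathcal{L}_+v_0=0$ and $xv_0=\varphi(x)v_0$ for $x\in\mathcal{L}_0$. The Verma module is $\bar V(\varphi)=U(\mathcal{L})\otimes_{U(\mathcal{L}_0+\mathcal{L}_+)}\mathbb{C}v_0$.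 *)

theory Defs
  imports
    "HOL-Computational_Algebra.Polynomial"
    "HOL-Algebra.Free_Abelian_Groups"
    "HOL-Algebra.QuotRing"
    "HOL-Algebra.Module"
begin

section \<open>The loop-Virasoro algebra\<close>

text \<open>Complex vector spaces with a given basis \<open>B\<close> are rendered as the finitely supported functions
  \<open>B \<Rightarrow>\<^sub>0 complex\<close>.\<close>

definition cscale :: "complex \<Rightarrow> ('b \<Rightarrow>\<^sub>0 complex) \<Rightarrow> ('b \<Rightarrow>\<^sub>0 complex)" where
  "cscale a x = Poly_Mapping.map ((*) a) x"

datatype vir_basis = C | D int

type_synonym vir = "vir_basis \<Rightarrow>\<^sub>0 complex"

text \<open>With the convolution product of \<^theory>\<open>HOL-Library.Poly_Mapping\<close> this is the ring of
  Laurent polynomials; \<open>Poly_Mapping.single k 1\<close> is \<open>t\<^sup>k\<close>.\<close>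

type_synonym laurent = "int \<Rightarrow>\<^sub>0 complex"

text \<open>\<open>Vir \<otimes> \<complex>[t, t\<^sup>-\<^sup>1]\<close>: the index \<open>(b, j)\<close> stands for the basis vector \<open>b \<otimes> t\<^sup>j\<close>.\<close>

type_synonym loop_vir = "(vir_basis \<times> int) \<Rightarrow>\<^sub>0 complex"

definition vir_c :: vir where
  "vir_c = Poly_Mapping.single C 1"

definition vir_d :: "int \<Rightarrow> vir" where
  "vir_d i = Poly_Mapping.single (D i) 1"

definition t_pow :: "int \<Rightarrow> laurent" where
  "t_pow k = Poly_Mapping.single k 1"

definition laurent_of_poly :: "complex poly \<Rightarrow> laurent" where
  "laurent_of_poly P =
    (\<Sum>i\<le>Polynomial.degree P. Poly_Mapping.single (int i) (Polynomial.coeff P i))"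

definition loop_tensor :: "vir \<Rightarrow> laurent \<Rightarrow> loop_vir" where
  "loop_tensor x f =
    (\<Sum>b\<in>Poly_Mapping.keys x. \<Sum>j\<in>Poly_Mapping.keys f.
       Poly_Mapping.single (b, j) (Poly_Mapping.lookup x b * Poly_Mapping.lookup f j))"

fun vir_basis_bracket :: "vir_basis \<Rightarrow> vir_basis \<Rightarrow> vir" where
  "vir_basis_bracket (D m) (D n) =
     cscale (of_int (n - m)) (vir_d (m + n))
     + (if m = - n then cscale ((of_int m ^ 3 - of_int m) / 12) vir_c else 0)"
| "vir_basis_bracket _ _ = 0"

definition loop_bracket :: "loop_vir \<Rightarrow> loop_vir \<Rightarrow> loop_vir" where
  "loop_bracket x y =
    (\<Sum>(b, j)\<in>Poly_Mapping.keys x. \<Sum>(b', l)\<in>Poly_Mapping.keys y.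
       cscale (Poly_Mapping.lookup x (b, j) * Poly_Mapping.lookup y (b', l))
         (loop_tensor (vir_basis_bracket b b') (t_pow (j + l))))"

lemma cscale_simps [simp]:
  "cscale a 0 = 0" "cscale 1 x = x" "cscale 0 x = 0"
  "cscale a (Poly_Mapping.single b z) = Poly_Mapping.single b (a * z)"
  by (rule poly_mapping_eqI; simp add: cscale_def map.rep_eq lookup_single when_def)+

lemma loop_tensor_single [simp]:
  "loop_tensor (Poly_Mapping.single b a) (Poly_Mapping.single j z)
     = Poly_Mapping.single (b, j) (a * z)"
  by (simp add: loop_tensor_def)

lemma loop_bracket_d_d:
  "loop_bracket (loop_tensor (vir_d i) (t_pow j)) (loop_tensor (vir_d k) (t_pow l)) =
     cscale (of_int (k - i)) (loop_tensor (vir_d (i + k)) (t_pow (j + l)))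
     + (if i + k = 0
        then cscale ((of_int i ^ 3 - of_int i) / 12) (loop_tensor vir_c (t_pow (j + l))) else 0)"
proof -
  have tensor_sum: "loop_tensor (Poly_Mapping.single (D m) a + Poly_Mapping.single C a')
      (Poly_Mapping.single n 1)
    = Poly_Mapping.single (D m, n) a + Poly_Mapping.single (C, n) a'" for m n a a'
  proof -
    have "Poly_Mapping.keys (Poly_Mapping.single (D m) a + Poly_Mapping.single C a')
        \<subseteq> {D m, C}"
      using Poly_Mapping.keys_add[of "Poly_Mapping.single (D m) a" "Poly_Mapping.single C a'"]
      by (auto split: if_splits)
    then have "loop_tensor (Poly_Mapping.single (D m) a + Poly_Mapping.single C a')
        (Poly_Mapping.single n 1)
      = (\<Sum>b\<in>{D m, C}. Poly_Mapping.single (b, n)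
          (Poly_Mapping.lookup (Poly_Mapping.single (D m) a + Poly_Mapping.single C a') b))"
      unfolding loop_tensor_def
      by (subst sum.mono_neutral_left[of "{D m, C}"]) (auto simp: in_keys_iff)
    then show ?thesis
      by (simp add: lookup_add lookup_single)
  qed
  show ?thesis
    using eq_neg_iff_add_eq_0[of i k] tensor_sum[of "i + k" "of_int (k - i)" 0 "j + l"]
    by (simp add: loop_bracket_def vir_d_def vir_c_def t_pow_def tensor_sum)
qed

lemma loop_bracket_c:
  "loop_bracket (loop_tensor vir_c (t_pow l)) y = 0"
  "loop_bracket y (loop_tensor vir_c (t_pow l)) = 0"
proof -
  have b0: "vir_basis_bracket b C = 0" "loop_tensor 0 f = 0" for b f
    by (cases b) (auto simp: loop_tensor_def)
  show "loop_bracket (loop_tensor vir_c (t_pow l)) y = 0"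
    "loop_bracket y (loop_tensor vir_c (t_pow l)) = 0"
    by (simp_all add: loop_bracket_def vir_c_def t_pow_def b0)
qed

fun basis_degree :: "vir_basis \<Rightarrow> int" where
  "basis_degree C = 0"
| "basis_degree (D i) = i"

definition loop_deg :: "int \<Rightarrow> loop_vir set" where
  "loop_deg i = {x. \<forall>(b, j)\<in>Poly_Mapping.keys x. basis_degree b = i}"

definition loop_plus :: "loop_vir set" where
  "loop_plus = {x. \<forall>(b, j)\<in>Poly_Mapping.keys x. basis_degree b > 0}"

definition loop_borel :: "loop_vir set" where
  "loop_borel = {x + y | x y. x \<in> loop_deg 0 \<and> y \<in> loop_plus}"

text \<open>The projection of the loop-Virasoro algebra onto its homogeneous component of degree \<open>i\<close>.\<close>

definition loop_component :: "int \<Rightarrow> loop_vir \<Rightarrow> loop_vir" where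
  "loop_component i x =
    (\<Sum>p\<in>{p \<in> Poly_Mapping.keys x. basis_degree (fst p) = i}.
       Poly_Mapping.single p (Poly_Mapping.lookup x p))"


section \<open>Universal enveloping algebras\<close>

text \<open>Words form a monoid under concatenation, so that \<open>'x list \<Rightarrow>\<^sub>0 complex\<close> with the convolution
  product of \<^theory>\<open>HOL-Library.Poly_Mapping\<close> is the free associative unital algebra on \<open>'x\<close>.\<close>

instantiation list :: (type) monoid_add
begin

definition zero_list :: "'a list" where
  "zero_list = []"

definition plus_list :: "'a list \<Rightarrow> 'a list \<Rightarrow> 'a list" where
  "plus_list = (@)"

instance
  by standard (simp_all add: zero_list_def plus_list_def)

end

definition free_alg :: "'x set \<Rightarrow> ('x list \<Rightarrow>\<^sub>0 complex) ring" where
  "free_alg S = \<lparr>carrier = {f. \<forall>w\<in>Poly_Mapping.keys f. set w \<subseteq> S},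
     monoid.mult = (*), one = 1, zero = 0, add = (+)\<rparr>"

definition uea_relations :: "loop_vir set \<Rightarrow> (loop_vir list \<Rightarrow>\<^sub>0 complex) set" where
  "uea_relations \<gg> =
     {Poly_Mapping.single [x + y] 1 - Poly_Mapping.single [x] 1 - Poly_Mapping.single [y] 1
        | x y. x \<in> \<gg> \<and> y \<in> \<gg>}
   \<union> {Poly_Mapping.single [cscale a x] 1 - Poly_Mapping.single [x] a | a x. x \<in> \<gg>}
   \<union> {Poly_Mapping.single [x, y] 1 - Poly_Mapping.single [y, x] 1
        - Poly_Mapping.single [loop_bracket x y] 1 | x y. x \<in> \<gg> \<and> y \<in> \<gg>}"

definition uea_ideal :: "loop_vir set \<Rightarrow> (loop_vir list \<Rightarrow>\<^sub>0 complex) set" where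
  "uea_ideal \<gg> = genideal (free_alg \<gg>) (uea_relations \<gg>)"

text \<open>\<open>U(\<gg>)\<close> for a Lie subalgebra \<open>\<gg>\<close> of the loop-Virasoro algebra: the first two families of
  relations turn the free algebra on the set \<open>\<gg>\<close> into the tensor algebra of the vector space \<open>\<gg>\<close>.\<close>

definition uea :: "loop_vir set \<Rightarrow> (loop_vir list \<Rightarrow>\<^sub>0 complex) set ring" where
  "uea \<gg> = free_alg \<gg> Quot uea_ideal \<gg>"

text \<open>The algebra homomorphism \<open>U(\<hh>) \<rightarrow> U(\<gg>)\<close> induced by an inclusion \<open>\<hh> \<subseteq> \<gg>\<close>.\<close>

definition uea_incl ::
  "loop_vir set \<Rightarrow> (loop_vir list \<Rightarrow>\<^sub>0 complex) set \<Rightarrow> (loop_vir list \<Rightarrow>\<^sub>0 complex) set" where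
  "uea_incl \<gg> X = (\<Union>f\<in>X. uea_ideal \<gg> +>\<^bsub>free_alg \<gg>\<^esub> f)"


section \<open>Modules over noncommutative rings\<close>

text \<open>\<open>M \<otimes>\<^sub>R N\<close> for a right \<open>R\<close>-module \<open>M\<close> with action \<open>ract\<close> and a left \<open>R\<close>-module \<open>N\<close>: the free
  abelian group on \<open>M \<times> N\<close> modulo biadditivity and balancedness.\<close>

definition tensor_relations ::
  "('r, 's) ring_scheme \<Rightarrow> ('m, 't) ring_scheme \<Rightarrow> ('m \<Rightarrow> 'r \<Rightarrow> 'm) \<Rightarrow> ('r, 'n) module
    \<Rightarrow> ('m \<times> 'n \<Rightarrow>\<^sub>0 int) set" where
  "tensor_relations R M ract N =
     {frag_of (m \<oplus>\<^bsub>M\<^esub> m', n) - frag_of (m, n) - frag_of (m', n)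
        | m m' n. m \<in> carrier M \<and> m' \<in> carrier M \<and> n \<in> carrier N}
   \<union> {frag_of (m, n \<oplus>\<^bsub>N\<^esub> n') - frag_of (m, n) - frag_of (m, n')
        | m n n'. m \<in> carrier M \<and> n \<in> carrier N \<and> n' \<in> carrier N}
   \<union> {frag_of (ract m r, n) - frag_of (m, r \<odot>\<^bsub>N\<^esub> n)
        | m r n. m \<in> carrier M \<and> r \<in> carrier R \<and> n \<in> carrier N}"

text \<open>If moreover another ring acts on \<open>M\<close> from the left by \<open>lact\<close>, compatibly with \<open>ract\<close>, it acts
  on the tensor product by \<open>u (m \<otimes> n) = (u m) \<otimes> n\<close>. The multiplicative fields of the record type
  of modules carry no meaning.\<close>

definition tensor_module ::
  "('r, 's) ring_scheme \<Rightarrow> ('m, 't) ring_scheme \<Rightarrow> ('u \<Rightarrow> 'm \<Rightarrow> 'm) \<Rightarrow> ('m \<Rightarrow> 'r \<Rightarrow> 'm)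
    \<Rightarrow> ('r, 'n) module \<Rightarrow> ('u, ('m \<times> 'n \<Rightarrow>\<^sub>0 int) set) module" where
  "tensor_module R M lact ract N =
     (let F = free_Abelian_group (carrier M \<times> carrier N);
          K = generate F (tensor_relations R M ract N)
      in \<lparr>carrier = carrier (F Mod K), monoid.mult = undefined, one = undefined,
          zero = one (F Mod K), add = monoid.mult (F Mod K),
          smult = (\<lambda>u X. \<Union>x\<in>X. K #>\<^bsub>F\<^esub> frag_extend (\<lambda>(m, n). frag_of (lact u m, n)) x)\<rparr>)"

definition irreducible_module :: "('r, 's) ring_scheme \<Rightarrow> ('r, 'm) module \<Rightarrow> bool" where
  "irreducible_module R M \<longleftrightarrow>
     carrier M \<noteq> {\<zero>\<^bsub>M\<^esub>} \<and>
     (\<forall>N. submodule N R M \<longrightarrow> N = {\<zero>\<^bsub>M\<^esub>} \<or> N = carrier M)"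


section \<open>Verma modules\<close>

text \<open>The scalar by which \<open>x \<in> \<L>\<^sub>0 + \<L>\<^sub>+\<close> acts on \<open>v\<^sub>0\<close>.\<close>

definition borel_character :: "(loop_vir \<Rightarrow> complex) \<Rightarrow> loop_vir \<Rightarrow> complex" where
  "borel_character \<phi> x = \<phi> (loop_component 0 x)"

definition free_alg_eval :: "('x \<Rightarrow> complex) \<Rightarrow> ('x list \<Rightarrow>\<^sub>0 complex) \<Rightarrow> complex" where
  "free_alg_eval \<chi> f =
     (\<Sum>w\<in>Poly_Mapping.keys f. Poly_Mapping.lookup f w * prod_list (map \<chi> w))"

text \<open>\<open>\<complex> v\<^sub>0\<close> as a module over \<open>U(\<L>\<^sub>0 + \<L>\<^sub>+)\<close>, with \<open>z v\<^sub>0\<close> written as \<open>z\<close>; all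
  representatives of a class of \<open>U(\<L>\<^sub>0 + \<L>\<^sub>+)\<close> act by the same scalar.\<close>

definition highest_weight_line ::
  "(loop_vir \<Rightarrow> complex) \<Rightarrow> ((loop_vir list \<Rightarrow>\<^sub>0 complex) set, complex) module" where
  "highest_weight_line \<phi> = \<lparr>carrier = UNIV, monoid.mult = (*), one = 1, zero = 0, add = (+),
     smult = (\<lambda>X z. the_elem (free_alg_eval (borel_character \<phi>) ` X) * z)\<rparr>"

definition verma_module ::
  "(loop_vir \<Rightarrow> complex) \<Rightarrow>
    ((loop_vir list \<Rightarrow>\<^sub>0 complex) set, ((loop_vir list \<Rightarrow>\<^sub>0 complex) set \<times> complex \<Rightarrow>\<^sub>0 int) set) module"
  where
  "verma_module \<phi> =
     tensor_module (uea loop_borel) (uea UNIV)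
       (\<lambda>u m. u \<otimes>\<^bsub>uea UNIV\<^esub> m)
       (\<lambda>m r. m \<otimes>\<^bsub>uea UNIV\<^esub> uea_incl UNIV r)
       (highest_weight_line \<phi>)"

end

theory Submission
  imports Defs "HOL-Library.Product_Lexorder"
begin

text \<open>By the Poincare-Birkhoff-Witt theorem the Verma module is the space of polynomials in the letters
  \<open>d\<^sub>i \<otimes> t\<^sup>k\<close> with \<open>i < 0\<close>, filtered by polynomial degree.

  If \<open>\<phi> (d\<^sub>0 \<otimes> t\<^sup>k P) = 0\<close> for all \<open>k\<close>, then \<open>(d\<^sub>-\<^sub>1 \<otimes> P) v\<^sub>0\<close> generates a proper submodule:
  moving the elements of nonnegative degree of a word to the right shows that no element of
  \<open>U(\<L>) (d\<^sub>-\<^sub>1 \<otimes> P) v\<^sub>0\<close> has a component along \<open>v\<^sub>0\<close>.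

  Conversely, let \<open>p\<close> be killed by all \<open>d\<^sub>1 \<otimes> t\<^sup>n\<close>. Modulo lower filtration \<open>d\<^sub>1 \<otimes> t\<^sup>n\<close> acts by the
  derivation \<open>d\<^sub>i \<otimes> t\<^sup>k \<mapsto> (i - 1) d\<^sub>i\<^sub>+\<^sub>1 \<otimes> t\<^sup>k\<^sup>+\<^sup>n\<close>, and for large \<open>n\<close> all letters
  \<open>d\<^sub>i\<^sub>+\<^sub>1 \<otimes> t\<^sup>k\<^sup>+\<^sup>n\<close> are new, so they can be treated as independent variables; hence the top part of \<open>p\<close>
  involves only letters \<open>d\<^sub>-\<^sub>1 \<otimes> t\<^sup>k\<close>. One filtration step lower, the terms that contain a shifted letter
  again vanish for large \<open>n\<close>. Their coefficients do not depend on \<open>n\<close>, so they vanish for every \<open>n\<close>.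
  What remains is \<open>\<Sum>\<^sub>k \<phi> (d\<^sub>0 \<otimes> t\<^sup>k\<^sup>+\<^sup>n) \<partial>p/\<partial>(d\<^sub>-\<^sub>1 \<otimes> t\<^sup>k) = 0\<close> for all \<open>n\<close>, and any nonzero coefficient of the
  partial derivatives yields \<open>P\<close>. If there is no such \<open>P\<close>, then every nonzero vector can therefore be raised
  to a nonzero multiple of \<open>v\<^sub>0\<close>.\<close>

section \<open>Linear extension\<close>

alias lookup = Poly_Mapping.lookup
alias single = Poly_Mapping.single
alias keys = Poly_Mapping.keys

lemma lookup_cscale [simp]: "lookup (cscale a x) b = a * lookup x b"
  by (simp add: cscale_def map.rep_eq when_def)

lemma cscale_add_right: "cscale a (x + y) = cscale a x + cscale a y"
  by (rule poly_mapping_eqI) (simp add: lookup_add algebra_simps)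

lemma cscale_cscale [simp]: "cscale a (cscale b x) = cscale (a * b) x"
  by (rule poly_mapping_eqI) simp

lemma cscale_minus_one: "cscale (- 1) x = - x"
  by (rule poly_mapping_eqI) simp

lemma keys_cscale: "keys (cscale a x) \<subseteq> keys x"
  by (auto simp: in_keys_iff)

text \<open>The linear functional with prescribed values on the basis; \<open>vext\<close> is its
  vector-valued counterpart. Most maps below are such extensions, so that identities reduce to basis
  elements.\<close>

definition sext :: "('w \<Rightarrow> complex) \<Rightarrow> ('w \<Rightarrow>\<^sub>0 complex) \<Rightarrow> complex" where
  "sext \<chi> f = (\<Sum>w\<in>keys f. lookup f w * \<chi> w)"

definition vext :: "('w \<Rightarrow> 'm \<Rightarrow>\<^sub>0 complex) \<Rightarrow> ('w \<Rightarrow>\<^sub>0 complex) \<Rightarrow> 'm \<Rightarrow>\<^sub>0 complex" where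
  "vext g f = (\<Sum>w\<in>keys f. cscale (lookup f w) (g w))"

lemma sext_superset:
  assumes "finite A" "keys f \<subseteq> A"
  shows "sext \<chi> f = (\<Sum>w\<in>A. lookup f w * \<chi> w)"
  unfolding sext_def using assms by (intro sum.mono_neutral_left) (auto simp: in_keys_iff)

lemma sext_cong: "f = f' \<Longrightarrow> (\<And>w. w \<in> keys f' \<Longrightarrow> \<chi> w = \<chi>' w) \<Longrightarrow> sext \<chi> f = sext \<chi>' f'"
  by (simp add: sext_def)

text \<open>The attribute lets the recursion of \<open>normal_form\<close> pass under
  \<open>vext\<close>.\<close>

lemma vext_cong [fundef_cong]:
  "f = f' \<Longrightarrow> (\<And>w. w \<in> keys f' \<Longrightarrow> g w = g' w) \<Longrightarrow> vext g f = vext g' f'"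
  by (simp add: vext_def)

lemma sext_zero [simp]: "sext \<chi> 0 = 0"
  by (simp add: sext_def)

lemma sext_single [simp]: "sext \<chi> (single w a) = a * \<chi> w"
  by (simp add: sext_def)

lemma sext_add: "sext \<chi> (f + g) = sext \<chi> f + sext \<chi> g"
proof -
  have "keys (f + g) \<subseteq> keys f \<union> keys g"
    by (rule Poly_Mapping.keys_add)
  then show ?thesis
    by (simp add: sext_superset[of "keys f \<union> keys g"] lookup_add algebra_simps sum.distrib)
qed

lemma sext_cscale: "sext \<chi> (cscale a f) = a * sext \<chi> f"
  by (subst sext_superset[OF finite_keys keys_cscale])
    (simp add: sext_def sum_distrib_left mult.assoc)

lemma sext_uminus: "sext \<chi> (- f) = - sext \<chi> f"
  using sext_cscale[of \<chi> "- 1" f] by (simp add: cscale_minus_one)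

lemma sext_diff: "sext \<chi> (f - g) = sext \<chi> f - sext \<chi> g"
  using sext_add[of \<chi> f "- g"] by (simp add: sext_uminus)

lemma sext_sum: "sext \<chi> (\<Sum>i\<in>I. f i) = (\<Sum>i\<in>I. sext \<chi> (f i))"
  by (induction I rule: infinite_finite_induct) (simp_all add: sext_add)

lemma sext_fun_zero [simp]: "sext (\<lambda>w. 0) f = 0"
  by (simp add: sext_def)

lemma sext_fun_add: "sext (\<lambda>w. \<chi> w + \<psi> w) f = sext \<chi> f + sext \<psi> f"
  by (simp add: sext_def algebra_simps sum.distrib)

lemma sext_fun_diff: "sext (\<lambda>w. \<chi> w - \<psi> w) f = sext \<chi> f - sext \<psi> f"
  by (simp add: sext_def algebra_simps sum_subtractf)

lemma sext_fun_mult: "sext (\<lambda>w. a * \<chi> w) f = a * sext \<chi> f"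
  by (simp add: sext_def sum_distrib_left mult.left_commute)

lemma sext_fun_sum: "sext (\<lambda>w. \<Sum>i\<in>I. \<chi> i w) f = (\<Sum>i\<in>I. sext (\<chi> i) f)"
  unfolding sext_def by (subst sum.swap) (simp add: sum_distrib_left)

lemma sext_commute:
  "sext (\<lambda>a. sext (\<lambda>b. h a b) g) f = sext (\<lambda>b. sext (\<lambda>a. h a b) f) g"
  unfolding sext_def by (simp add: sum_distrib_left mult.left_commute sum.swap[of _ "keys g"])

lemma lookup_vext [simp]: "lookup (vext g f) T = sext (\<lambda>w. lookup (g w) T) f"
  by (simp add: vext_def sext_def lookup_sum)

lemma vext_zero [simp]: "vext g 0 = 0"
  by (simp add: vext_def)

lemma vext_single [simp]: "vext g (single w a) = cscale a (g w)"
  by (rule poly_mapping_eqI) simp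

lemma vext_add: "vext g (f + f') = vext g f + vext g f'"
  by (rule poly_mapping_eqI) (simp add: sext_add lookup_add)

lemma vext_cscale: "vext g (cscale a f) = cscale a (vext g f)"
  by (rule poly_mapping_eqI) (simp add: sext_cscale)

lemma vext_uminus: "vext g (- f) = - vext g f"
  by (rule poly_mapping_eqI) (simp add: sext_uminus)

lemma vext_diff: "vext g (f - f') = vext g f - vext g f'"
  by (rule poly_mapping_eqI) (simp add: sext_diff lookup_minus)

lemma vext_fun_zero [simp]: "vext (\<lambda>w. 0) f = 0"
  by (rule poly_mapping_eqI) simp

lemma vext_fun_add: "vext (\<lambda>w. g w + h w) f = vext g f + vext h f"
  by (rule poly_mapping_eqI) (simp add: sext_fun_add lookup_add)

lemma vext_fun_diff: "vext (\<lambda>w. g w - h w) f = vext g f - vext h f"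
  by (rule poly_mapping_eqI) (simp add: sext_fun_diff lookup_minus)

lemma vext_fun_cscale: "vext (\<lambda>w. cscale a (g w)) f = cscale a (vext g f)"
  by (rule poly_mapping_eqI) (simp add: sext_fun_mult)

lemma vext_commute:
  "vext (\<lambda>a. vext (\<lambda>b. h a b) g) f = vext (\<lambda>b. vext (\<lambda>a. h a b) f) g"
  by (rule poly_mapping_eqI) (simp, rule sext_commute)

lemma sext_vext: "sext \<chi> (vext g f) = sext (\<lambda>w. sext \<chi> (g w)) f"
  unfolding vext_def by (simp add: sext_sum sext_cscale) (simp add: sext_def)

lemma vext_vext: "vext h (vext g f) = vext (\<lambda>w. vext h (g w)) f"
  by (rule poly_mapping_eqI) (simp add: sext_vext)

lemma vext_basis [simp]: "vext (\<lambda>w. single w 1) f = f"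
proof -
  have "sext (\<lambda>w. lookup (single w 1) T) f = lookup f T" for T
    by (cases "T \<in> keys f")
      (auto simp: sext_def lookup_single when_def if_distrib sum.delta in_keys_iff cong: if_cong)
  then show ?thesis
    by (intro poly_mapping_eqI) simp
qed

lemma keys_vext: "keys (vext g f) \<subseteq> (\<Union>w\<in>keys f. keys (g w))"
proof
  fix T assume "T \<in> keys (vext g f)"
  then have "sext (\<lambda>w. lookup (g w) T) f \<noteq> 0"
    by (simp add: in_keys_iff)
  then obtain w where "w \<in> keys f" "lookup (g w) T \<noteq> 0"
    unfolding sext_def by (metis (no_types, lifting) mult_zero_right sum.neutral)
  then show "T \<in> (\<Union>w\<in>keys f. keys (g w))"
    by (auto simp: in_keys_iff)
qed


section \<open>The Poincare-Birkhoff-Witt theorem\<close>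

fun inversions :: "'b::linorder list \<Rightarrow> nat" where
  "inversions [] = 0"
| "inversions (x # w) = length (filter (\<lambda>y. y < x) w) + inversions w"

lemma inversions_swap:
  "y < x \<Longrightarrow> inversions (u @ y # x # v) < inversions (u @ x # y # v)"
  by (induction u) auto

lemma unsorted_descent:
  assumes "\<not> sorted w"
  obtains u x y v where "w = u @ x # y # v" "y < x"
proof -
  have "\<not> sorted w \<Longrightarrow> \<exists>u x y v. w = u @ x # y # v \<and> y < x"
  proof (induction w)
    case (Cons a w)
    show ?case
    proof (cases "sorted w")
      case True
      with Cons.prems obtain b w' where "w = b # w'" "b < a"
        by (cases w) force+
      then have "a # w = [] @ a # b # w' \<and> b < a"
        by simp
      then show ?thesis by blast
    next
      case False
      with Cons.IH obtain u x y v where "w = u @ x # y # v" "y < x" by blast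
      then have "a # w = (a # u) @ x # y # v \<and> y < x"
        by simp
      then show ?thesis by blast
    qed
  qed simp
  then show ?thesis using assms that by blast
qed

text \<open>The choice is arbitrary, and unspecified on sorted words; \<open>N_descent\<close> shows
  that normal forms do not depend on it.\<close>

definition descent :: "'b::linorder list \<Rightarrow> 'b list \<times> 'b \<times> 'b \<times> 'b list" where
  "descent w = (SOME (u, x, y, v). w = u @ x # y # v \<and> y < x)"

lemma descentD:
  assumes "\<not> sorted w" "descent w = (u, x, y, v)"
  shows "w = u @ x # y # v" "y < x"
proof -
  have "case descent w of (u, x, y, v) \<Rightarrow> w = u @ x # y # v \<and> y < x"
    unfolding descent_def using unsorted_descent[OF assms(1)]
    by (intro someI_ex[of "\<lambda>(u, x, y, v). w = u @ x # y # v \<and> y < x"]) (metis (lifting) case_prodI)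
  with assms(2) show "w = u @ x # y # v" "y < x" by auto
qed

text \<open>Swapping a descent keeps the length and lowers the number of inversions, while a bracket
  term loses a letter; the lexicographic order handles both.\<close>

definition word_order :: "('b::linorder list \<times> 'b list) set" where
  "word_order = measures [length, inversions]"

lemma wf_word_order [simp]: "wf word_order"
  by (simp add: word_order_def)

lemma word_order_shorter: "length w < length w' \<Longrightarrow> (w, w') \<in> word_order"
  by (simp add: word_order_def)

lemma word_order_swap: "y < x \<Longrightarrow> (u @ y # x # v, u @ x # y # v) \<in> word_order"
  by (simp add: word_order_def inversions_swap)

text \<open>Induction along straightening: a descent is traced back to the swapped word and to all
  words with one letter in place of two, which cover the terms of the bracket.\<close>

lemma word_induct [case_names sorted descent]:
  assumes "\<And>w. sorted w \<Longrightarrow> P w"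
    and "\<And>u x y v. y < x \<Longrightarrow> P (u @ y # x # v) \<Longrightarrow> (\<And>c. P (u @ c # v)) \<Longrightarrow> P (u @ x # y # v)"
  shows "P w"
proof (induction w rule: wf_induct_rule[OF wf_word_order])
  case (1 w)
  show ?case
  proof (cases "sorted w")
    case False
    then obtain u x y v where w: "w = u @ x # y # v" "y < x"
      by (rule unsorted_descent)
    show ?thesis unfolding w(1)
      by (rule assms(2)[OF w(2)]; rule 1; simp add: w word_order_swap word_order_shorter)
  qed (rule assms(1))
qed

text \<open>A Lie algebra given by structure constants on a totally ordered basis. Antisymmetry at
  \<open>x = y\<close> yields \<open>br_self\<close>, since 2 is invertible.\<close>

locale lie_basis =
  fixes br :: "'b::linorder \<Rightarrow> 'b \<Rightarrow> 'b \<Rightarrow>\<^sub>0 complex"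
  assumes br_antisym: "br x y = - br y x"
    and br_jacobi: "vext (\<lambda>c. br c z) (br x y) + vext (\<lambda>c. br c x) (br y z)
      + vext (\<lambda>c. br c y) (br z x) = 0"
begin

text \<open>The form in which the Poincare-Birkhoff-Witt theorem is used: arbitrary values
  \<open>base\<close> on sorted words extend to all words, compatibly with the bracket by
  \<open>N_commute\<close>.\<close>

function normal_form ::
  "('b list \<Rightarrow> 'm \<Rightarrow>\<^sub>0 complex) \<Rightarrow> 'b list \<Rightarrow> 'm \<Rightarrow>\<^sub>0 complex" where
  "normal_form base w = (if sorted w then base w
     else case descent w of (u, x, y, v) \<Rightarrow>
       normal_form base (u @ y # x # v) + vext (\<lambda>c. normal_form base (u @ c # v)) (br x y))"
  by auto

termination
proof (relation "inv_image word_order snd")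
  show "wf (inv_image word_order snd)"
    by simp
qed (metis descentD in_inv_image snd_conv word_order_swap,
     metis descentD in_inv_image snd_conv word_order_shorter
       length_append length_Cons add_less_cancel_left lessI)

declare normal_form.simps [simp del]

lemma br_self [simp]: "br x x = 0"
proof (rule poly_mapping_eqI)
  fix c
  have "lookup (br x x) c = - lookup (br x x) c"
    by (metis br_antisym lookup_uminus)
  then show "lookup (br x x) c = lookup 0 c"
    by simp
qed

context
  fixes base :: "'b list \<Rightarrow> 'm \<Rightarrow>\<^sub>0 complex"
begin

abbreviation "N \<equiv> normal_form base"

lemma N_sorted: "sorted w \<Longrightarrow> N w = base w"
  by (simp add: normal_form.simps)

text \<open>Jacobson's argument: resolving any descent of a word, not only the chosen one, yields its normal form.
  Disjoint descents commute, and for overlapping ones the Jacobi identity makes the two results agree.\<close>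

definition reduct where
  "reduct u x y v = N (u @ y # x # v) + vext (\<lambda>c. N (u @ c # v)) (br x y)"

text \<open>Either reduction leaves the other descent intact in every resulting word, so the
  hypotheses resolve it there as well and both sides become the same four terms;
  \<open>vext_commute\<close> matches the double brackets.\<close>

lemma reduct_disjoint:
  assumes IH: "\<And>w u v. (w, a @ x # y # b @ x' # y' # c) \<in> word_order \<Longrightarrow> w = u @ x # y # v
      \<Longrightarrow> N w = reduct u x y v"
    and IH': "\<And>w u v. (w, a @ x # y # b @ x' # y' # c) \<in> word_order \<Longrightarrow> w = u @ x' # y' # v
      \<Longrightarrow> N w = reduct u x' y' v"
    and "y < x" "y' < x'"
  shows "reduct a x y (b @ x' # y' # c) = reduct (a @ x # y # b) x' y' c"
proof -
  let ?w = "a @ x # y # b @ x' # y' # c"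
  have 1: "N (a @ y # x # b @ x' # y' # c) = reduct (a @ y # x # b) x' y' c"
    by (rule IH') (simp_all add: word_order_swap assms)
  have 2: "N (a @ e # b @ x' # y' # c) = reduct (a @ e # b) x' y' c" for e
    by (rule IH') (simp_all add: word_order_shorter)
  have "(a @ x # y # b @ y' # x' # c, ?w) \<in> word_order"
    using word_order_swap[OF assms(4), of "a @ x # y # b" c] by simp
  then have 3: "N (a @ x # y # b @ y' # x' # c) = reduct a x y (b @ y' # x' # c)"
    by (rule IH) (simp_all add: assms)
  have 4: "N (a @ x # y # b @ e # c) = reduct a x y (b @ e # c)" for e
    by (rule IH) (simp_all add: word_order_shorter assms)
  show ?thesis
    using 1 2 3 4
    by (simp add: reduct_def vext_fun_add add.assoc add.left_commute
        vext_commute[of "\<lambda>e e'. N (a @ e # b @ e' # c)"])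
qed

text \<open>Both sides are straightened down to the fully reversed block \<open>z\<close>,
  \<open>y\<close>, \<open>x\<close>. The words of full length cancel, and the remaining commutators
  add up to the Jacobi identity.\<close>

lemma reduct_overlap:
  assumes IH: "\<And>w u p q v. (w, a @ x # y # z # c) \<in> word_order \<Longrightarrow> w = u @ p # q # v
      \<Longrightarrow> q < p \<Longrightarrow> N w = reduct u p q v"
    and "y < x" "z < y"
  shows "reduct a x y (z # c) = reduct (a @ [x]) y z c"
proof -
  let ?w = "a @ x # y # z # c"
  \<comment> \<open>One letter shorter, a swap may be undone by antisymmetry, so no order between
    \<open>p\<close> and \<open>q\<close> is assumed.\<close>
  have shorter: "N (a @ p # q # c) = reduct a p q c" for p q
  proof (cases p q rule: linorder_cases)
    case less
    have "N (a @ q # p # c) = reduct a q p c"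
      by (rule IH) (simp_all add: word_order_shorter less)
    then show ?thesis
      by (simp add: reduct_def br_antisym[of p q] vext_uminus)
  next
    case greater
    show ?thesis
      by (rule IH) (simp_all add: word_order_shorter greater)
  qed (simp add: reduct_def)
  define L where "L = (\<lambda>f. vext (\<lambda>e. N (a @ e # c)) f)"
  have bracket: "vext (\<lambda>e. N (a @ e # q # c)) f - vext (\<lambda>e. N (a @ q # e # c)) f
      = L (vext (\<lambda>e. br e q) f)" for q f
    by (simp add: vext_fun_diff[symmetric] shorter[of _ q] reduct_def L_def vext_vext)
  have o1: "(a @ y # x # z # c, ?w) \<in> word_order" "(a @ x # z # y # c, ?w) \<in> word_order"
    using word_order_swap[OF assms(2), of a "z # c"] word_order_swap[OF assms(3), of "a @ [x]" c]
    by simp_all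
  have "z < x"
    using assms by simp
  then have o2: "(a @ y # z # x # c, ?w) \<in> word_order" "(a @ z # x # y # c, ?w) \<in> word_order"
    using o1 word_order_swap[of z x "a @ [y]" c] word_order_swap[of z x a "y # c"]
    by (auto simp: word_order_def)
  have "N (a @ y # x # z # c) = reduct (a @ [y]) x z c"
    "N (a @ y # z # x # c) = reduct a y z (x # c)"
    "N (a @ x # z # y # c) = reduct a x z (y # c)"
    "N (a @ z # x # y # c) = reduct (a @ [z]) x y c"
    by (rule IH[OF o1(1)] IH[OF o2(1)] IH[OF o1(2)] IH[OF o2(2)]; use assms in simp)+
  then have "reduct a x y (z # c) - reduct (a @ [x]) y z c
      = (vext (\<lambda>e. N (a @ e # z # c)) (br x y) - vext (\<lambda>e. N (a @ z # e # c)) (br x y))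
      + (vext (\<lambda>e. N (a @ e # x # c)) (br y z) - vext (\<lambda>e. N (a @ x # e # c)) (br y z))
      - (vext (\<lambda>e. N (a @ e # y # c)) (br x z) - vext (\<lambda>e. N (a @ y # e # c)) (br x z))"
    by (simp add: reduct_def)
  also have "\<dots> = L (vext (\<lambda>e. br e z) (br x y)) + L (vext (\<lambda>e. br e x) (br y z))
      + L (vext (\<lambda>e. br e y) (br z x))"
    by (simp add: bracket br_antisym[of x z] vext_uminus L_def)
  also have "\<dots> = L 0"
    by (simp add: L_def vext_add[symmetric] br_jacobi)
  finally show ?thesis
    by (simp add: L_def)
qed

lemma descents_cases:
  assumes "u @ x # y # v = u' @ x' # y' # v'" "length u < length u'"
  obtains "u' = u @ [x]" "x' = y" "v = y' # v'"
  | b where "u' = u @ x # y # b" "v = b @ x' # y' # v'"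
proof -
  obtain d where d: "u' = u @ d" "x # y # v = d @ x' # y' # v'" "d \<noteq> []"
    using assms by (auto simp: append_eq_append_conv2)
  then obtain d' where "d = x # d'" "y # v = d' @ x' # y' # v'"
    by (cases d) auto
  then show ?thesis
    using d that by (cases d') auto
qed

text \<open>Induction on \<open>word_order\<close>: the descent at hand is compared with the one
  that \<open>normal_form\<close> picked, by \<open>reduct_disjoint\<close> or
  \<open>reduct_overlap\<close>.\<close>

theorem N_descent:
  assumes "y < x"
  shows "N (u @ x # y # v) = N (u @ y # x # v) + vext (\<lambda>c. N (u @ c # v)) (br x y)"
proof -
  have "w = u @ x # y # v \<Longrightarrow> y < x \<Longrightarrow> N w = reduct u x y v" for w u x y v
  proof (induction w arbitrary: u x y v rule: wf_induct_rule[OF wf_word_order])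
    case (1 w)
    have unsorted: "\<not> sorted w"
      using 1(2,3) by (auto simp: sorted_append)
    obtain u' x' y' v' where d: "descent w = (u', x', y', v')"
      by (cases "descent w")
    note w' = descentD[OF unsorted d]
    have Nw: "N w = reduct u' x' y' v'"
      using unsorted d by (simp add: normal_form.simps[of _ w] reduct_def)
    \<comment> \<open>Stated for two arbitrary descents, as the chosen one may lie on either side of
      the given one.\<close>
    have agree: "reduct u x y v = reduct u' x' y' v'"
      if "w = u @ x # y # v" "y < x" "w = u' @ x' # y' # v'" "y' < x'" "length u < length u'"
      for u x y v u' x' y' v'
      using that(1)[unfolded that(3)]
    proof (rule descents_cases[OF sym that(5)])
      assume *: "u' = u @ [x]" "x' = y" "v = y' # v'"
      show ?thesis unfolding *
        by (rule reduct_overlap) (use that * 1(1) in auto)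
    next
      fix b assume *: "u' = u @ x # y # b" "v = b @ x' # y' # v'"
      show ?thesis unfolding *
        by (rule reduct_disjoint) (use that * 1(1) in auto)
    qed
    show ?case
    proof (cases "length u" "length u'" rule: linorder_cases)
      case less
      show ?thesis
        unfolding Nw by (rule agree[symmetric, OF 1(2,3) w' less])
    next
      case greater
      show ?thesis
        unfolding Nw by (rule agree[OF w' 1(2,3) greater])
    next
      case equal
      then show ?thesis
        using Nw w' 1(2) by auto
    qed
  qed
  from this[OF refl assms] show ?thesis
    by (simp add: reduct_def)
qed

text \<open>Antisymmetry removes the condition on the order, so \<open>N\<close> respects the
  bracket relations at every adjacent pair.\<close>

theorem N_commute:
  "N (u @ x # y # v) = N (u @ y # x # v) + vext (\<lambda>c. N (u @ c # v)) (br x y)"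
proof (cases x y rule: linorder_cases)
  case less
  then show ?thesis
    using N_descent[of x y u v] by (simp add: br_antisym[of x y] vext_uminus)
qed (simp_all add: N_descent)

end

end

section \<open>Highest weight modules\<close>

lemma vext_fun_scalar: "vext (\<lambda>c. cscale (\<chi> c) S) f = cscale (sext \<chi> f) S"
  by (rule poly_mapping_eqI) (simp add: sext_def sum_distrib_right mult.assoc)

text \<open>A graded Lie algebra in which letters of negative degree precede all others. By
  \<open>char_br\<close>, \<chi> is a one-dimensional representation of the part of nonnegative
  degree.\<close>

locale triangular_lie_basis = lie_basis br
  for br :: "'b::linorder \<Rightarrow> 'b \<Rightarrow> 'b \<Rightarrow>\<^sub>0 complex" +
  fixes deg :: "'b \<Rightarrow> int" and \<chi> :: "'b \<Rightarrow> complex"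
  assumes deg_br: "c \<in> keys (br x y) \<Longrightarrow> deg c = deg x + deg y"
    and neg_less: "deg x < 0 \<Longrightarrow> deg y \<ge> 0 \<Longrightarrow> x < y"
    and char_deg: "deg x \<noteq> 0 \<Longrightarrow> \<chi> x = 0"
    and char_br: "deg x \<ge> 0 \<Longrightarrow> deg y \<ge> 0 \<Longrightarrow> sext \<chi> (br x y) = 0"
begin

definition char_word :: "'b list \<Rightarrow> complex" where
  "char_word z = prod_list (map \<chi> z)"

lemma char_word_simps [simp]:
  "char_word [] = 1" "char_word (b # z) = \<chi> b * char_word z"
  "char_word (y @ z) = char_word y * char_word z"
  by (simp_all add: char_word_def)

text \<open>In a sorted word the letters of negative degree come first, so the other ones reach \<open>v\<^sub>0\<close> and
  act by \<open>\<chi>\<close>.\<close>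

definition verma_base :: "'b list \<Rightarrow> 'b multiset \<Rightarrow>\<^sub>0 complex" where
  "verma_base w = cscale (char_word (filter (\<lambda>b. deg b \<ge> 0) w))
     (single (mset (filter (\<lambda>b. deg b < 0) w)) 1)"

text \<open>The word applied to the highest weight vector, where a multiset of negative letters
  stands for their sorted product.\<close>

definition verma_word :: "'b list \<Rightarrow> 'b multiset \<Rightarrow>\<^sub>0 complex" where
  "verma_word = normal_form verma_base"

lemmas verma_word_commute = N_commute[of verma_base, folded verma_word_def]

lemma verma_word_sorted: "sorted w \<Longrightarrow> verma_word w = verma_base w"
  by (simp add: verma_word_def N_sorted)

lemma sorted_split:
  assumes "sorted w"
  obtains n z where "w = n @ z" "sorted n" "\<forall>b\<in>set n. deg b < 0" "\<forall>b\<in>set z. deg b \<ge> 0"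
proof -
  have "\<exists>n z. w = n @ z \<and> (\<forall>b\<in>set n. deg b < 0) \<and> (\<forall>b\<in>set z. deg b \<ge> 0)"
    using assms
  proof (induction w)
    case (Cons a w)
    then obtain n z where w: "w = n @ z" "\<forall>b\<in>set n. deg b < 0" "\<forall>b\<in>set z. deg b \<ge> 0"
      by auto
    show ?case
    proof (cases "deg a < 0")
      case True
      with w have "a # w = (a # n) @ z \<and> (\<forall>b\<in>set (a # n). deg b < 0) \<and> (\<forall>b\<in>set z. deg b \<ge> 0)"
        by simp
      then show ?thesis by blast
    next
      case False
      have "n = []"
      proof (rule ccontr)
        assume "n \<noteq> []"
        then obtain b where "b \<in> set n" by (meson last_in_set)
        then have "b < a" "a \<le> b"
          using w False neg_less Cons.prems by auto
        then show False by simp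
      qed
      with w False have "a # w = [] @ a # z \<and> (\<forall>b\<in>set []. deg b < 0) \<and> (\<forall>b\<in>set (a # z). deg b \<ge> 0)"
        by simp
      then show ?thesis by blast
    qed
  qed simp
  then show ?thesis
    using assms that by (auto simp: sorted_append)
qed

lemma filter_neg:
  "\<forall>b\<in>set n. deg b < 0 \<Longrightarrow> filter (\<lambda>b. deg b < 0) n = n"
  "\<forall>b\<in>set n. deg b < 0 \<Longrightarrow> filter (\<lambda>b. deg b \<ge> 0) n = []"
  "\<forall>b\<in>set n. deg b \<ge> 0 \<Longrightarrow> filter (\<lambda>b. deg b \<ge> 0) n = n"
  "\<forall>b\<in>set n. deg b \<ge> 0 \<Longrightarrow> filter (\<lambda>b. deg b < 0) n = []"
  by (auto simp: filter_empty_conv)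

text \<open>The block \<open>z\<close> may be unsorted: straightening it only produces brackets of
  letters of nonnegative degree, on which \<chi> vanishes.\<close>

lemma verma_word_sorted_neg_append:
  assumes "sorted n" "\<forall>b\<in>set n. deg b < 0" "\<forall>b\<in>set z. deg b \<ge> 0"
  shows "verma_word (n @ z) = cscale (char_word z) (single (mset n) 1)"
  using assms(3)
proof (induction z rule: word_induct)
  case (sorted z)
  then have "sorted (n @ z)"
    using assms neg_less by (auto simp: sorted_append intro: less_imp_le)
  with sorted show ?case
    by (simp add: verma_word_sorted verma_base_def filter_neg assms)
next
  case (descent u x y v)
  define S where "S = cscale (char_word u * char_word v) (single (mset n) 1)"
  have "verma_word (n @ u @ c # v) = cscale (\<chi> c) S" if "c \<in> keys (br x y)" for c
    using descent.IH(2)[of c] descent.prems deg_br[OF that] by (simp add: mult_ac S_def)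
  then have "vext (\<lambda>c. verma_word (n @ u @ c # v)) (br x y) = vext (\<lambda>c. cscale (\<chi> c) S) (br x y)"
    by (intro vext_cong refl)
  then have "vext (\<lambda>c. verma_word (n @ u @ c # v)) (br x y) = 0"
    using descent.prems by (simp add: vext_fun_scalar char_br)
  then show ?case
    using descent verma_word_commute[of "n @ u" x y v] by (simp add: mult_ac)
qed

text \<open>Induction on \<open>u\<close>: resolving a descent in \<open>u\<close> does not touch
  \<open>z\<close>, and the nonnegative end of a sorted \<open>u\<close> merges with
  \<open>z\<close> into one block.\<close>

lemma verma_word_append_nonneg:
  "\<forall>b\<in>set z. deg b \<ge> 0 \<Longrightarrow> verma_word (u @ z) = cscale (char_word z) (verma_word u)"
proof (induction u arbitrary: z rule: word_induct)
  case (sorted u)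
  then obtain n z' where "u = n @ z'" "sorted n" "\<forall>b\<in>set n. deg b < 0" "\<forall>b\<in>set z'. deg b \<ge> 0"
    by (metis sorted_split)
  then show ?case
    using sorted verma_word_sorted_neg_append[of n "z' @ z"]  verma_word_sorted_neg_append[of n z']
    by (auto simp: mult_ac)
next
  case (descent u x y v)
  then show ?case
    using verma_word_commute[of u x y "v @ z"] verma_word_commute[of u x y v]
    by (simp add: cscale_add_right vext_fun_cscale)
qed

text \<open>Brackets add degrees, so a negative letter in a bracket needs a negative argument, and
  the number of such letters never grows. Nonnegative letters must have degree 0 to act by a nonzero
  scalar, so the total degree survives their removal.\<close>

lemma keys_verma_word:
  assumes "T \<in> keys (verma_word w)"
  shows "\<forall>b\<in>#T. deg b < 0" "(\<Sum>b\<in>#T. deg b) = sum_list (map deg w)"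
    "size T \<le> length (filter (\<lambda>b. deg b < 0) w)"
proof -
  have "(\<forall>b\<in>#T. deg b < 0) \<and> (\<Sum>b\<in>#T. deg b) = sum_list (map deg w)
      \<and> size T \<le> length (filter (\<lambda>b. deg b < 0) w)"
    using assms
  proof (induction w rule: word_induct)
    case (sorted w)
    then obtain n z where w: "w = n @ z" "sorted n" "\<forall>b\<in>set n. deg b < 0" "\<forall>b\<in>set z. deg b \<ge> 0"
      by (metis sorted_split)
    with sorted have T: "T = mset n" "char_word z \<noteq> 0"
      by (auto simp: verma_word_sorted_neg_append in_keys_iff lookup_single when_def split: if_splits)
    have "sum_list (map deg z) = 0" if "char_word z \<noteq> 0" for z
      using that char_deg by (induction z) auto
    with T w show ?case
      by (simp add: filter_neg flip: sum_mset_sum_list)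
  next
    case (descent u x y v)
    have "T \<in> keys (verma_word (u @ y # x # v))
        \<or> (\<exists>c\<in>keys (br x y). T \<in> keys (verma_word (u @ c # v)))"
      using descent.prems Poly_Mapping.keys_add keys_vext unfolding verma_word_commute[of u x y v]
      by fastforce
    then show ?case
    proof
      assume "\<exists>c\<in>keys (br x y). T \<in> keys (verma_word (u @ c # v))"
      then obtain c where c: "c \<in> keys (br x y)" "T \<in> keys (verma_word (u @ c # v))" by blast
      show ?thesis
        using descent.IH(2)[OF c(2)] deg_br[OF c(1)] by (auto split: if_splits)
    qed (use descent.IH(1) in \<open>auto split: if_splits\<close>)
  qed
  then show "\<forall>b\<in>#T. deg b < 0" "(\<Sum>b\<in>#T. deg b) = sum_list (map deg w)"
    "size T \<le> length (filter (\<lambda>b. deg b < 0) w)" by auto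
qed

text \<open>Bracket terms have fewer letters and cannot reach size \<open>length w\<close>, so in
  top filtration degree the letters commute.\<close>

lemma lookup_verma_word_leading:
  assumes "\<forall>b\<in>set w. deg b < 0" "size T = length w"
  shows "lookup (verma_word w) T = (if mset w = T then 1 else 0)"
  using assms
proof (induction w rule: word_induct)
  case (sorted w)
  then show ?case
    using verma_word_sorted_neg_append[of w "[]"] by (simp add: lookup_single when_def)
next
  case (descent u x y v)
  have "lookup (verma_word (u @ c # v)) T = 0" for c
    using keys_verma_word(3)[of T "u @ c # v"] descent.prems
      length_filter_le[of "\<lambda>b. deg b < 0" "u @ c # v"]
    by (auto simp: in_keys_iff simp del: length_filter_le filter_append)
  then show ?case
    using descent
    by (simp add: verma_word_commute[of u x y v] lookup_add add.commute[of "mset u"] add_mset_commute)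
qed

section \<open>The Verma space and the action of basis elements\<close>

definition verma_space :: "('b multiset \<Rightarrow>\<^sub>0 complex) set" where
  "verma_space = {p. \<forall>T\<in>keys p. \<forall>b\<in>#T. deg b < 0}"

lemma verma_word_mem [simp]: "verma_word w \<in> verma_space"
  by (auto simp: verma_space_def dest: keys_verma_word(1))

lemma verma_space_vext: "(\<And>w. g w \<in> verma_space) \<Longrightarrow> vext g f \<in> verma_space"
  unfolding verma_space_def using keys_vext[of g f] by blast

lemma single_verma_space:
  assumes "single T 1 \<in> verma_space"
  shows "verma_word (sorted_list_of_multiset T) = single T 1"
  using assms verma_word_sorted_neg_append[of "sorted_list_of_multiset T" "[]"]
  by (auto simp: verma_space_def sorted_sorted_list_of_multiset)

lemma verma_space_expand:
  assumes "p \<in> verma_space"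
  shows "p = vext (\<lambda>T. verma_word (sorted_list_of_multiset T)) p"
proof -
  have "vext (\<lambda>T. verma_word (sorted_list_of_multiset T)) p = vext (\<lambda>T. single T 1) p"
    using assms by (intro vext_cong) (auto intro!: single_verma_space simp: verma_space_def)
  then show ?thesis by simp
qed

definition act :: "'b \<Rightarrow> ('b multiset \<Rightarrow>\<^sub>0 complex) \<Rightarrow> 'b multiset \<Rightarrow>\<^sub>0 complex" where
  "act b p = vext (\<lambda>T. verma_word (b # sorted_list_of_multiset T)) p"

lemma act_mem [simp]: "act b p \<in> verma_space"
  unfolding act_def by (rule verma_space_vext) simp

text \<open>\<open>act\<close> is defined through sorted words only; both sides obey the same
  straightening rule, which carries the formula to all words.\<close>

lemma act_verma_word: "act b (verma_word w) = verma_word (b # w)"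
proof (induction w rule: word_induct)
  case (sorted w)
  then obtain n z where "w = n @ z" "sorted n" "\<forall>b\<in>set n. deg b < 0" "\<forall>b\<in>set z. deg b \<ge> 0"
    by (metis sorted_split)
  then show ?case
    using verma_word_append_nonneg[of z "b # n"]
    by (simp add: verma_word_sorted_neg_append act_def sorted_sort_id)
next
  case (descent u x y v)
  then show ?case
    using verma_word_commute[of u x y v] verma_word_commute[of "b # u" x y v]
    by (simp add: act_def vext_add vext_vext)
qed

lemma act_add: "act b (p + q) = act b p + act b q"
  by (simp add: act_def vext_add)

lemma act_cscale: "act b (cscale a p) = cscale a (act b p)"
  by (simp add: act_def vext_cscale)

lemma act_vext: "act b (vext g f) = vext (\<lambda>w. act b (g w)) f"
  by (simp add: act_def vext_vext)

lemma act_act: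
  assumes "p \<in> verma_space"
  shows "act b (act c p) = vext (\<lambda>T. verma_word (b # c # sorted_list_of_multiset T)) p"
  by (subst verma_space_expand[OF assms]) (simp add: act_vext act_verma_word)

lemma act_commute:
  assumes "p \<in> verma_space"
  shows "act x (act y p) = act y (act x p) + vext (\<lambda>c. act c p) (br x y)"
proof -
  have "vext (\<lambda>c. act c p) (br x y)
      = vext (\<lambda>T. vext (\<lambda>c. verma_word (c # sorted_list_of_multiset T)) (br x y)) p"
    unfolding act_def by (rule vext_commute)
  then show ?thesis
    using verma_word_commute[of "[]" x y] by (simp add: act_act assms vext_fun_add)
qed

end

text \<open>Links the convolution product with \<open>vext\<close>; it serves both words under
  concatenation and exponents of Laurent polynomials.\<close>

lemma mult_vext: "f * g = vext (\<lambda>u. vext (\<lambda>v. single (u + v) 1) g) (f :: 'w::monoid_add \<Rightarrow>\<^sub>0 complex)"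
proof -
  have sum_single: "h = (\<Sum>w\<in>keys h. single w (lookup h w))" for h :: "'w \<Rightarrow>\<^sub>0 complex"
    using vext_basis[of h, unfolded vext_def cscale_simps mult_1_right] by (rule sym)
  have "f * g = (\<Sum>u\<in>keys f. single u (lookup f u)) * (\<Sum>v\<in>keys g. single v (lookup g v))"
    by (rule arg_cong2[where f = "(*)"]) (rule sum_single)+
  also have "\<dots> = (\<Sum>u\<in>keys f. \<Sum>v\<in>keys g. single (u + v) (lookup f u * lookup g v))"
    by (simp add: sum_product mult_single)
  also have "\<dots> = (\<Sum>u\<in>keys f. cscale (lookup f u) (\<Sum>v\<in>keys g. single (u + v) (lookup g v)))"
    by (intro sum.cong refl poly_mapping_eqI)
      (simp add: lookup_sum lookup_single sum_distrib_left mult_when)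
  finally show ?thesis
    by (simp add: vext_def)
qed

section \<open>The action of the Lie algebra and of the free associative algebra\<close>

context triangular_lie_basis
begin

definition lbr :: "('b \<Rightarrow>\<^sub>0 complex) \<Rightarrow> ('b \<Rightarrow>\<^sub>0 complex) \<Rightarrow> 'b \<Rightarrow>\<^sub>0 complex" where
  "lbr x y = vext (\<lambda>b. vext (br b) y) x"

definition lact :: "('b \<Rightarrow>\<^sub>0 complex) \<Rightarrow> ('b multiset \<Rightarrow>\<^sub>0 complex) \<Rightarrow> 'b multiset \<Rightarrow>\<^sub>0 complex" where
  "lact x p = vext (\<lambda>b. act b p) x"

lemma lact_mem [simp]: "lact x p \<in> verma_space"
  unfolding lact_def by (rule verma_space_vext) simp

lemma lact_linear:
  "lact (x + y) p = lact x p + lact y p" "lact (cscale a x) p = cscale a (lact x p)"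
  "lact x (p + q) = lact x p + lact x q" "lact x (cscale a p) = cscale a (lact x p)"
  by (simp_all add: lact_def vext_add vext_cscale act_add act_cscale vext_fun_add vext_fun_cscale)

lemma lact_single: "lact (single b 1) p = act b p"
  by (simp add: lact_def)

lemma lact_vext: "lact x (vext g f) = vext (\<lambda>w. lact x (g w)) f"
  unfolding lact_def act_vext by (rule vext_commute)

lemma lact_commute:
  assumes "p \<in> verma_space"
  shows "lact x (lact y p) = lact y (lact x p) + lact (lbr x y) p"
proof -
  have "lact x (lact y p) = vext (\<lambda>b. vext (\<lambda>c. act b (act c p)) y) x"
    by (simp add: lact_def act_vext)
  also have "\<dots> = vext (\<lambda>b. vext (\<lambda>c. act c (act b p)) y) x
      + vext (\<lambda>b. vext (\<lambda>c. vext (\<lambda>e. act e p) (br b c)) y) x"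
    by (subst act_commute[OF assms]) (simp add: vext_fun_add)
  also have "vext (\<lambda>b. vext (\<lambda>c. act c (act b p)) y) x = lact y (lact x p)"
    by (simp add: lact_def act_vext vext_commute[of _ y])
  finally show ?thesis
    by (simp add: lact_def lbr_def vext_vext)
qed

definition free_act ::
  "(('b \<Rightarrow>\<^sub>0 complex) list \<Rightarrow>\<^sub>0 complex) \<Rightarrow> ('b multiset \<Rightarrow>\<^sub>0 complex) \<Rightarrow> 'b multiset \<Rightarrow>\<^sub>0 complex" where
  "free_act g p = vext (\<lambda>w. foldr lact w p) g"

lemma foldr_lact_linear:
  "foldr lact w (p + q) = foldr lact w p + foldr lact w q"
  "foldr lact w (cscale a p) = cscale a (foldr lact w p)"
  by (induction w) (simp_all add: lact_linear)

lemma foldr_lact_vext: "foldr lact w (vext g f) = vext (\<lambda>u. foldr lact w (g u)) f"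
  by (induction w) (simp_all add: lact_vext)

lemma foldr_lact_mem: "p \<in> verma_space \<Longrightarrow> foldr lact w p \<in> verma_space"
  by (cases w) simp_all

lemma free_act_mem [simp]: "p \<in> verma_space \<Longrightarrow> free_act g p \<in> verma_space"
  unfolding free_act_def by (rule verma_space_vext) (rule foldr_lact_mem)

lemma free_act_linear:
  "free_act (f + g) p = free_act f p + free_act g p"
  "free_act (f - g) p = free_act f p - free_act g p"
  "free_act (- f) p = - free_act f p"
  "free_act f (p + q) = free_act f p + free_act f q"
  "free_act f (cscale a p) = cscale a (free_act f p)"
  by (simp_all add: free_act_def vext_add vext_diff vext_uminus foldr_lact_linear vext_fun_add
      vext_fun_cscale)

lemma free_act_single [simp]: "free_act (single w a) p = cscale a (foldr lact w p)"
  by (simp add: free_act_def)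

lemma free_act_0 [simp]: "free_act 0 p = 0" "free_act f 0 = 0"
  using free_act_linear(5)[of f 0 0] by (simp_all add: free_act_def)

lemma free_act_mult: "free_act (f * g) p = free_act f (free_act g p)"
  by (simp add: free_act_def mult_vext[of f g] vext_vext foldr_lact_vext plus_list_def)

definition highest :: "'b multiset \<Rightarrow>\<^sub>0 complex" where
  "highest = single {#} 1"

lemma verma_word_Nil: "verma_word [] = highest"
  by (simp add: highest_def verma_word_sorted verma_base_def)

lemma highest_mem [simp]: "highest \<in> verma_space"
  by (simp add: highest_def verma_space_def)

lemma lact_highest:
  assumes "\<forall>b\<in>keys x. deg b \<ge> 0"
  shows "lact x highest = cscale (sext \<chi> x) highest"
proof -
  have "act b highest = cscale (\<chi> b) highest" if "b \<in> keys x" for b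
    using verma_word_append_nonneg[of "[b]" "[]"] assms that
    by (simp add: verma_word_Nil flip: act_verma_word)
  then have "lact x highest = vext (\<lambda>b. cscale (\<chi> b) highest) x"
    unfolding lact_def by (intro vext_cong refl)
  then show ?thesis
    by (simp add: vext_fun_scalar)
qed

lemma free_act_highest:
  assumes "\<forall>w\<in>keys f. \<forall>x\<in>set w. \<forall>b\<in>keys x. deg b \<ge> 0"
  shows "free_act f highest = cscale (sext (\<lambda>w. prod_list (map (sext \<chi>) w)) f) highest"
proof -
  have "foldr lact w highest = cscale (prod_list (map (sext \<chi>) w)) highest"
    if "\<forall>x\<in>set w. \<forall>b\<in>keys x. deg b \<ge> 0" for w
    using that by (induction w) (simp_all add: lact_highest lact_linear mult.commute)
  then have "free_act f highest = vext (\<lambda>w. cscale (prod_list (map (sext \<chi>) w)) highest) f"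
    unfolding free_act_def using assms by (intro vext_cong refl) blast
  then show ?thesis
    by (simp add: vext_fun_scalar)
qed

end


section \<open>The loop-Virasoro algebra as a triangular Lie algebra\<close>

instantiation vir_basis :: linorder
begin

text \<open>Placing \<open>C\<close> at the top makes every basis element of negative degree smaller than all others.\<close>

definition less_eq_vir_basis :: "vir_basis \<Rightarrow> vir_basis \<Rightarrow> bool" where
  "x \<le> y \<longleftrightarrow> (case y of C \<Rightarrow> True | D j \<Rightarrow> (case x of C \<Rightarrow> False | D i \<Rightarrow> i \<le> j))"

definition less_vir_basis :: "vir_basis \<Rightarrow> vir_basis \<Rightarrow> bool" where
  "x < y \<longleftrightarrow> x \<le> y \<and> x \<noteq> (y :: vir_basis)"

instance
  by standard (auto simp: less_eq_vir_basis_def less_vir_basis_def split: vir_basis.splits)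

end

definition loop_br :: "vir_basis \<times> int \<Rightarrow> vir_basis \<times> int \<Rightarrow> loop_vir" where
  "loop_br p q = loop_tensor (vir_basis_bracket (fst p) (fst q)) (t_pow (snd p + snd q))"

lemma loop_bracket_vext: "loop_bracket x y = vext (\<lambda>p. vext (loop_br p) y) x"
proof -
  have "loop_bracket x y = (\<Sum>p\<in>keys x. \<Sum>q\<in>keys y. cscale (lookup x p * lookup y q) (loop_br p q))"
    by (simp add: loop_bracket_def loop_br_def split_def)
  also have "\<dots> = vext (\<lambda>p. vext (loop_br p) y) x"
    by (intro poly_mapping_eqI) (simp add: lookup_sum sext_def sum_distrib_left mult.assoc)
  finally show ?thesis .
qed

lemma loop_br_C [simp]: "loop_br (C, j) q = 0" "loop_br p (C, j) = 0"
proof -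
  have "vir_basis_bracket b C = 0" "loop_tensor 0 f = 0" for b f
    by (cases b) (auto simp: loop_tensor_def)
  then show "loop_br (C, j) q = 0" "loop_br p (C, j) = 0"
    by (simp_all add: loop_br_def)
qed

lemma loop_br_D:
  "loop_br (D i, j) (D k, l) = single (D (i + k), j + l) (of_int (k - i))
     + (if i + k = 0 then single (C, j + l) ((of_int i ^ 3 - of_int i) / 12) else 0)"
  using loop_bracket_d_d[of i j k l]
  by (simp add: loop_bracket_vext vir_d_def vir_c_def t_pow_def)

lemma loop_br_antisym: "loop_br p q = - loop_br q p"
proof -
  obtain b j b' l where pq: "p = (b, j)" "q = (b', l)"
    by (metis surj_pair)
  show ?thesis
  proof (cases "C \<in> {b, b'}")
    case False
    then obtain i k where D: "b = D i" "b' = D k"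
      by (metis insert_iff vir_basis.exhaust)
    have "complex_of_int i = - of_int k" if "i + k = 0"
      using that by (simp add: eq_neg_iff_add_eq_0 flip: of_int_add)
    define f where "f = (\<lambda>x. (of_int x ^ 3 - of_int x) / (12 :: complex))"
    have br: "loop_br (D i, j) (D k, l) = single (D (i + k), j + l) (of_int (k - i))
        + (if i + k = 0 then single (C, j + l) (f i) else 0)" for i j k l
      by (simp add: loop_br_D f_def)
    have "f i = - f k" if "i + k = 0"
      using \<open>i + k = 0 \<Longrightarrow> _\<close>[OF that] by (simp add: f_def field_simps)
    then show ?thesis
      unfolding pq D br add.commute[of k] add.commute[of l]
      by (intro poly_mapping_eqI) (simp add: lookup_add lookup_minus lookup_single when_def)
  qed (auto simp: pq)
qed

lemma vext_loop_br_D: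
  "vext (\<lambda>p. loop_br p (D m, n)) (loop_br (D i, j) (D k, l))
     = single (D (i + k + m), j + l + n) (of_int (k - i) * of_int (m - (i + k)))
       + (if i + k + m = 0 then single (C, j + l + n)
            (of_int (k - i) * ((of_int (i + k) ^ 3 - of_int (i + k)) / 12)) else 0)"
proof -
  have "vext (\<lambda>p. loop_br p (D m, n)) (loop_br (D i, j) (D k, l))
     = cscale (of_int (k - i)) (loop_br (D (i + k), j + l) (D m, n))"
    by (simp add: loop_br_D[of i j k l] vext_add)
  then show ?thesis
    by (simp only: loop_br_D) (simp add: cscale_add_right)
qed

lemma loop_br_jacobi:
  "vext (\<lambda>p. loop_br p c) (loop_br a b) + vext (\<lambda>p. loop_br p a) (loop_br b c)
     + vext (\<lambda>p. loop_br p b) (loop_br c a) = 0"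
proof -
  obtain x i y j z k where abc: "a = (x, i)" "b = (y, j)" "c = (z, k)"
    by (metis surj_pair)
  \<comment> \<open>The three double brackets involve the same two basis vectors, so one scalar
    identity is needed for each of them.\<close>
  have sum0: "(single A a1 + (if Q then single B b1 else 0))
      + (single A a2 + (if Q then single B b2 else 0))
      + (single A a3 + (if Q then single B b3 else 0)) = 0"
    if "A \<noteq> B" "a1 + a2 + a3 = 0" "Q \<Longrightarrow> b1 + b2 + b3 = 0"
    for A B :: "vir_basis \<times> int" and Q and a1 a2 a3 b1 b2 b3 :: complex
    using that by (intro poly_mapping_eqI) (auto simp: lookup_add lookup_single when_def)
  show ?thesis
  proof (cases "C \<in> {x, y, z}")
    case True
    then show ?thesis by (auto simp: abc)
  next
    case False
    then obtain l m n where D: "x = D l" "y = D m" "z = D n"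
      by (metis insert_iff vir_basis.exhaust)
    have eqs: "j + k + i = i + j + k" "k + i + j = i + j + k" "m + n + l = l + m + n"
      "n + l + m = l + m + n"
      by simp_all
    show ?thesis
      unfolding abc D vext_loop_br_D eqs
    proof (rule sum0)
      assume "l + m + n = 0"
      then have n: "n = - l - m" by simp
      show "of_int (m - l) * ((of_int (l + m) ^ 3 - of_int (l + m)) / 12)
          + of_int (n - m) * ((of_int (m + n) ^ 3 - of_int (m + n)) / 12)
          + of_int (l - n) * ((of_int (n + l) ^ 3 - of_int (n + l)) / 12) = (0::complex)"
        by (simp add: n field_simps power3_eq_cube)
    qed (simp_all add: algebra_simps)
  qed
qed

lemma sext_eq_zero: "(\<And>w. w \<in> keys f \<Longrightarrow> \<chi> w = 0) \<Longrightarrow> sext \<chi> f = 0"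
  by (simp add: sext_def)

section \<open>Coefficients along the highest weight vector\<close>

context triangular_lie_basis
begin

text \<open>\<open>verma_word_commute\<close> iterated: passing the \<open>i\<close>-th letter of
  \<open>w\<close> costs one term in which that letter is replaced by the bracket.\<close>

lemma verma_word_move:
  "verma_word (u @ x # w @ v) = verma_word (u @ w @ x # v)
     + (\<Sum>i<length w. vext (\<lambda>c. verma_word (u @ w[i := c] @ v)) (br x (w ! i)))"
proof (induction w arbitrary: u)
  case (Cons y w)
  show ?case
    using verma_word_commute[of u x y "w @ v"] Cons.IH[of "u @ [y]"]
    by (simp add: sum.lessThan_Suc_shift add_ac del: sum.lessThan_Suc)
qed simp

text \<open>Degree reasons: the empty multiset has degree 0, whereas \<open>b\<close> lowers the
  degree of a vector whose monomials all have degree at most 0.\<close>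

lemma lookup_verma_word_neg_Cons:
  assumes "deg b < 0"
  shows "lookup (verma_word (b # w)) {#} = 0"
proof (rule ccontr)
  assume "lookup (verma_word (b # w)) {#} \<noteq> 0"
  then have "{#} \<in> keys (act b (verma_word w))"
    by (simp add: act_verma_word in_keys_iff)
  then obtain T where T: "T \<in> keys (verma_word w)"
      "{#} \<in> keys (verma_word (b # sorted_list_of_multiset T))"
    unfolding act_def using keys_vext by fastforce
  have "deg b + (\<Sum>b\<in>#T. deg b) = 0"
    using keys_verma_word(2)[OF T(2)] by (simp flip: sum_mset_sum_list)
  moreover have "(\<Sum>b\<in>#T. deg b) \<le> (\<Sum>b\<in>#T. 0)"
    using keys_verma_word(1)[OF T(1)] by (intro sum_mset_mono) (simp add: less_imp_le)
  ultimately show False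
    using assms by simp
qed

end

lemma loop_br_deg:
  assumes "c \<in> keys (loop_br p q)"
  shows "basis_degree (fst c) = basis_degree (fst p) + basis_degree (fst q)"
proof -
  obtain b j b' l where pq: "p = (b, j)" "q = (b', l)"
    by (metis surj_pair)
  show ?thesis
  proof (cases "C \<in> {b, b'}")
    case False
    then obtain i k where D: "b = D i" "b' = D k"
      by (metis insert_iff vir_basis.exhaust)
    show ?thesis
      using assms unfolding pq D loop_br_D
      by (auto simp: in_keys_iff lookup_add lookup_single when_def split: if_splits)
  qed (use assms pq in auto)
qed

locale loop_verma =
  fixes \<chi> :: "vir_basis \<times> int \<Rightarrow> complex"
  assumes loop_char_deg: "basis_degree (fst p) \<noteq> 0 \<Longrightarrow> \<chi> p = 0"

text \<open>The elements of degree 0 commute, so \<open>char_br\<close> holds for any values of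
  \<chi> there; in positive degree \<chi> vanishes by assumption.\<close>

sublocale loop_verma \<subseteq> triangular_lie_basis loop_br "\<lambda>p. basis_degree (fst p)" \<chi>
proof
  show "loop_br x y = - loop_br y x" for x y
    by (rule loop_br_antisym)
  show "vext (\<lambda>c. loop_br c z) (loop_br x y) + vext (\<lambda>c. loop_br c x) (loop_br y z)
      + vext (\<lambda>c. loop_br c y) (loop_br z x) = 0" for x y z
    by (rule loop_br_jacobi)
  show "basis_degree (fst c) = basis_degree (fst x) + basis_degree (fst y)"
    if "c \<in> keys (loop_br x y)" for c x y
    using that by (rule loop_br_deg)
  show "x < y" if "basis_degree (fst x) < 0" "basis_degree (fst y) \<ge> 0"
    for x y :: "vir_basis \<times> int"
    using that
    by (cases x; cases y; cases "fst x"; cases "fst y")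
      (auto simp: less_vir_basis_def less_eq_vir_basis_def)
  show "\<chi> x = 0" if "basis_degree (fst x) \<noteq> 0" for x
    using that by (rule loop_char_deg)
  show "sext \<chi> (loop_br x y) = 0"
    if "basis_degree (fst x) \<ge> 0" "basis_degree (fst y) \<ge> 0" for x y
  proof (cases "basis_degree (fst x) + basis_degree (fst y) = 0")
    case True
    with that have "basis_degree (fst x) = 0" "basis_degree (fst y) = 0"
      by auto
    then have "loop_br x y = 0"
      by (cases x; cases y; cases "fst x"; cases "fst y") (auto simp: loop_br_D)
    then show ?thesis by simp
  next
    case False
    then show ?thesis
      by (intro sext_eq_zero loop_char_deg) (simp add: loop_br_deg)
  qed
qed

context loop_verma
begin

text \<open>Here the word \<open>w\<close> acts on \<open>(d_{-1} \<otimes> Q) v_0\<close>. A first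
  letter of negative degree excludes a component along \<open>v_0\<close>. Any other first letter is
  moved to the right end; the terms arising on the way are covered by induction, or contain \<chi>
  of \<open>d_0 \<otimes> t^k Q\<close> or of a letter of positive degree.\<close>

lemma highest_coefficient_vanishes:
  assumes "\<And>k. sext (\<lambda>j. \<chi> (D 0, j + k)) Q = 0"
  shows "sext (\<lambda>j. lookup (verma_word (w @ [(D (- 1), j)])) {#}) Q = 0"
  using assms
proof (induction "length w" arbitrary: w Q rule: less_induct)
  case less
  show ?case
  proof (cases w)
    case Nil
    then show ?thesis
      by (simp add: lookup_verma_word_neg_Cons)
  next
    case (Cons b w')
    show ?thesis
    proof (cases "basis_degree (fst b) < 0")
      case True
      then show ?thesis
        by (simp add: Cons lookup_verma_word_neg_Cons)
    next
      case False
      define F where "F = (\<lambda>u. lookup (verma_word u) {#})"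
      have IH: "sext (\<lambda>j. F (u @ [(D (- 1), j)])) Q = 0" if "length u \<le> length w'" for u
        unfolding F_def using less that by (simp add: Cons)
      have F_nonneg: "F (u @ [c]) = \<chi> c * F u" if "basis_degree (fst c) \<ge> 0" for u c
        using that verma_word_append_nonneg[of "[c]" u] by (simp add: F_def)
      have F_bracket: "sext (\<lambda>j. sext (\<lambda>c. F (w' @ [c])) (loop_br b (D (- 1), j))) Q = 0"
      proof -
        obtain e k where b: "b = (e, k)" by (cases b)
        show ?thesis
        proof (cases e)
          case C
          then show ?thesis by (simp add: b)
        next
          case (D i)
          have "i \<ge> 0" using False by (simp add: b D)
          then consider "i = 0" | "i = 1" | "i \<ge> 2" by linarith
          then show ?thesis
          proof cases
            case 1
            \<comment> \<open>\<open>Q'\<close> is \<open>t^k Q\<close>, for which the induction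
              needs \<open>Q\<close> to be arbitrary; the factor \<open>- 1\<close> below comes from
              \<open>[d_0, d_{-1}] = - d_{-1}\<close>.\<close>
            define Q' where "Q' = vext (\<lambda>j. single (k + j) (1::complex)) Q"
            have "sext (\<lambda>j. \<chi> (vir_basis.D 0, j + m)) Q' = 0" for m
              using less.prems[of "k + m"] by (simp add: Q'_def sext_vext add_ac)
            then have "sext (\<lambda>j. F (w' @ [(vir_basis.D (- 1), j)])) Q' = 0"
              unfolding F_def using less.hyps[of w' Q'] by (simp add: Cons)
            then have "sext (\<lambda>j. F (w' @ [(vir_basis.D (- 1), k + j)])) Q = 0"
              by (simp add: Q'_def sext_vext)
            then show ?thesis
              using sext_fun_mult[of "- 1" "\<lambda>j. F (w' @ [(vir_basis.D (- 1), k + j)])" Q]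
              by (simp add: b D 1 loop_br_D)
          next
            case 2
            \<comment> \<open>The bracket of \<open>d_1\<close> and \<open>d_{-1}\<close> is
              \<open>- 2 d_0\<close>; its central term vanishes because \<open>i^3 - i\<close> is 0
              at \<open>i = 1\<close>.\<close>
            have "sext (\<lambda>j. \<chi> (vir_basis.D 0, k + j)) Q = 0"
              using less.prems[of k] by (simp add: add.commute)
            then show ?thesis
              using sext_fun_mult[of "- 2 * F w'" "\<lambda>j. \<chi> (vir_basis.D 0, k + j)" Q]
              by (simp add: b D 2 loop_br_D F_nonneg mult_ac)
          next
            case 3
            then show ?thesis
              by (simp add: b D loop_br_D F_nonneg loop_char_deg)
          qed
        qed
      qed
      have move: "F (b # w' @ [y]) = \<chi> b * F (w' @ [y]) + sext (\<lambda>c. F (w' @ [c])) (loop_br b y)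
          + (\<Sum>i<length w'. sext (\<lambda>c. F (w'[i := c] @ [y])) (loop_br b (w' ! i)))" for y
        using verma_word_move[of "[]" b w' "[y]"] verma_word_commute[of w' b y "[]"]
          F_nonneg[of b "w' @ [y]"] False
        by (simp add: F_def lookup_add lookup_sum)
      have "sext (\<lambda>j. sext (\<lambda>c. F (w'[i := c] @ [(D (- 1), j)])) (loop_br b (w' ! i))) Q = 0" for i
        by (subst sext_commute) (simp add: IH)
      then have "sext (\<lambda>j. F (b # w' @ [(D (- 1), j)])) Q = 0"
        unfolding move sext_fun_add sext_fun_sum sext_fun_mult
        by (simp add: IH F_bracket)
      then show ?thesis
        by (simp add: Cons F_def)
    qed
  qed
qed

end

section \<open>Singular vectors\<close>

text \<open>With \<open>shift_letter n\<close> this is the effect of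
  \<open>d_1 \<otimes> t^n\<close> on the letter \<open>d_i \<otimes> t^k\<close>, up to the factor
  \<open>i - 1\<close>. The value at \<open>C\<close> is a default that keeps the map
  injective.\<close>

fun raise_letter :: "vir_basis \<times> int \<Rightarrow> vir_basis \<times> int" where
  "raise_letter (D i, k) = (D (i + 1), k)"
| "raise_letter (C, k) = (C, k)"

fun shift_letter :: "int \<Rightarrow> vir_basis \<times> int \<Rightarrow> vir_basis \<times> int" where
  "shift_letter n (b, k) = (b, k + n)"

lemma raise_letter_inj [simp]: "raise_letter x = raise_letter y \<longleftrightarrow> x = y"
  by (cases x; cases y; cases "fst x"; cases "fst y") auto

lemma shift_letter_inj [simp]: "shift_letter n x = shift_letter n y \<longleftrightarrow> x = y"
  by (cases x; cases y) auto

text \<open>The shift \<open>B - b + 1\<close> carries every exponent in \<open>S\<close> beyond all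
  those in \<open>Z\<close>; \<open>insert 0\<close> covers empty sets.\<close>

lemma finite_fresh_shift:
  assumes "finite S" "finite Z"
  obtains n where "\<And>s. s \<in> S \<Longrightarrow> shift_letter n s \<notin> Z"
proof -
  define B where "B = Max (insert 0 (snd ` Z))"
  define b where "b = Min (insert 0 (snd ` S))"
  have "shift_letter (B - b + 1) s \<notin> Z" if "s \<in> S" for s
  proof
    assume "shift_letter (B - b + 1) s \<in> Z"
    then have "snd (shift_letter (B - b + 1) s) \<le> B"
      unfolding B_def using assms by (intro Max_ge) auto
    moreover have "b \<le> snd s"
      unfolding b_def using assms that by (intro Min_le) auto
    moreover have "snd (shift_letter (B - b + 1) s) = snd s + (B - b + 1)"
      by (cases s) simp
    ultimately show False by simp
  qed
  then show ?thesis using that by blast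
qed

context loop_verma
begin

abbreviation "ldeg p \<equiv> basis_degree (fst p)"

text \<open>For a word \<open>w\<close>, the part of degree \<open>q\<close> of \<open>(d\<^sub>1 \<otimes> t\<^sup>n) w\<close> that involves a shifted letter: a pair \<open>(A, s)\<close>
  stands for the monomial \<open>A\<close> times the letter \<open>s\<close> shifted by \<open>n\<close>. The pairs do not depend on \<open>n\<close>.\<close>

definition raise_pairs :: "nat \<Rightarrow> (vir_basis \<times> int) list
    \<Rightarrow> ((vir_basis \<times> int) multiset \<times> vir_basis \<times> int) \<Rightarrow>\<^sub>0 complex" where
  "raise_pairs q w =
    (if length w = q then
       \<Sum>i | i < length w \<and> ldeg (w ! i) < - 1.
         single (mset w - {#w ! i#}, raise_letter (w ! i)) (of_int (ldeg (w ! i)) - 1)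
     else if length w = Suc q then
       \<Sum>i<length w. \<Sum>l<q - i. single (mset w - {#w ! i#} - {#w ! (Suc (i + l))#},
         (D (- 1), snd (w ! i) + snd (w ! (Suc (i + l))))) 2
     else 0)"

text \<open>The part without a shifted letter, meant for words in letters of degree -1: one of them
  is raised to \<open>d_0 \<otimes> t^(k+n)\<close>, with the factor -2 of
  \<open>[d_1, d_{-1}]\<close>, and acts on \<open>v_0\<close> by \<chi>.\<close>

definition raise_scalar :: "nat \<Rightarrow> int \<Rightarrow> (vir_basis \<times> int) list \<Rightarrow> (vir_basis \<times> int) multiset
    \<Rightarrow> complex" where
  "raise_scalar q n w T =
    (if length w = Suc q then
       \<Sum>i<length w. of_bool (mset w - {#w ! i#} = T) * (- 2 * \<chi> (D 0, snd (w ! i) + n))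
     else 0)"

text \<open>Moved to the right end, \<open>d_1 \<otimes> t^n\<close> kills \<open>v_0\<close>, so
  only the brackets remain; at a letter of degree -1 the central term has coefficient 0.\<close>

lemma verma_word_raise:
  assumes "\<forall>b\<in>set w. ldeg b < 0"
  shows "verma_word ((D 1, n) # w)
    = (\<Sum>i<length w. cscale (of_int (ldeg (w ! i)) - 1)
        (verma_word (w[i := shift_letter n (raise_letter (w ! i))])))"
proof -
  have "vext (\<lambda>c. verma_word (w[i := c])) (loop_br (D 1, n) (w ! i))
      = cscale (of_int (ldeg (w ! i)) - 1) (verma_word (w[i := shift_letter n (raise_letter (w ! i))]))"
    if "i < length w" for i
  proof -
    have "ldeg (w ! i) < 0" using assms that by simp
    then obtain j k where "w ! i = (D j, k)"
      by (cases "w ! i"; cases "fst (w ! i)") auto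
    then show ?thesis
      by (simp add: loop_br_D add.commute)
  qed
  moreover have "verma_word (w @ [(D 1, n)]) = 0"
    using verma_word_append_nonneg[of "[(D 1, n)]" w] by (simp add: loop_char_deg)
  ultimately show ?thesis
    using verma_word_move[of "[]" "(D 1, n)" w "[]"] by simp
qed

lemma keys_sum_subset: "keys (\<Sum>i\<in>I. f i) \<subseteq> (\<Union>i\<in>I. keys (f i))"
proof
  fix x assume "x \<in> keys (\<Sum>i\<in>I. f i)"
  then have "(\<Sum>i\<in>I. lookup (f i) x) \<noteq> 0"
    by (simp add: in_keys_iff lookup_sum)
  then obtain i where "i \<in> I" "lookup (f i) x \<noteq> 0"
    by (meson sum.neutral)
  then show "x \<in> (\<Union>i\<in>I. keys (f i))"
    by (auto simp: in_keys_iff)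
qed

text \<open>\<open>A\<close> consists of letters of \<open>w\<close>, so that a letter shifted far
  enough can be told from those of \<open>A\<close>; the size places the monomial in filtration
  degree \<open>q\<close>.\<close>

lemma keys_raise_pairs:
  assumes "(A, s) \<in> keys (raise_pairs q w)"
  shows "Suc (size A) = q" "A \<subseteq># mset w"
proof -
  have "Suc (size A) = q \<and> A \<subseteq># mset w"
  proof (cases "length w = q")
    case True
    then have "(A, s) \<in> keys (\<Sum>i | i < length w \<and> ldeg (w ! i) < - 1.
        single (mset w - {#w ! i#}, raise_letter (w ! i)) (of_int (ldeg (w ! i)) - 1 :: complex))"
      using assms by (simp add: raise_pairs_def)
    from subsetD[OF keys_sum_subset this] obtain i where "i < length w" "A = mset w - {#w ! i#}"
      by (auto split: if_splits)
    then show ?thesis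
      using True by (auto simp: size_Diff_singleton)
  next
    case False
    then have len: "length w = Suc q"
      using assms by (auto simp: raise_pairs_def split: if_splits)
    then have "(A, s) \<in> keys (\<Sum>i<length w. \<Sum>l<q - i. single (mset w - {#w ! i#}
        - {#w ! (Suc (i + l))#}, (D (- 1), snd (w ! i) + snd (w ! (Suc (i + l))))) (2::complex))"
      using assms by (simp add: raise_pairs_def)
    from subsetD[OF keys_sum_subset this]
    obtain i where i: "i < length w" "(A, s) \<in> keys (\<Sum>l<q - i. single (mset w - {#w ! i#}
        - {#w ! (Suc (i + l))#}, (D (- 1), snd (w ! i) + snd (w ! (Suc (i + l))))) (2::complex))"
      by auto
    from subsetD[OF keys_sum_subset i(2)]
    obtain l where l: "l < q - i" "A = mset w - {#w ! i#} - {#w ! (Suc (i + l))#}"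
      by (auto split: if_splits)
    have "mset w - {#w ! i#} = mset (take i w @ drop (Suc i) w)"
      using i by (subst id_take_nth_drop[of i w]) auto
    moreover have "w ! (Suc (i + l)) = drop (Suc i) w ! l"
      using l len by simp
    moreover have "drop (Suc i) w ! l \<in> set (drop (Suc i) w)"
      using l len by (intro nth_mem) simp
    ultimately have mem: "w ! (Suc (i + l)) \<in># mset w - {#w ! i#}"
      by simp
    have "size (mset w - {#w ! i#}) = q"
      using i(1) len by (simp add: size_Diff_singleton)
    then have "size A = q - 1"
      unfolding l(2) using size_Diff_singleton[OF mem] by simp
    moreover have "A \<subseteq># mset w"
      unfolding l(2) by (meson diff_subset_eq_self subset_mset.order_trans)
    ultimately show ?thesis
      using l(1) by simp
  qed
  then show "Suc (size A) = q" "A \<subseteq># mset w" by auto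
qed

text \<open>Words with fewer than \<open>q\<close> letters contribute nothing. With \<open>q\<close>
  letters the leading term survives where the raised letter is still negative. With
  \<open>q + 1\<close> letters, all of degree -1, the raised letter
  \<open>d_0 \<otimes> t^(k+n)\<close> travels to the right: it acts on \<open>v_0\<close> or merges
  with a later letter.\<close>

lemma lookup_verma_word_raise:
  assumes neg: "\<forall>b\<in>set w. ldeg b < 0" and "length w \<le> Suc q"
    and top: "length w = Suc q \<Longrightarrow> \<forall>b\<in>set w. ldeg b = - 1" and T: "size T = q"
  shows "lookup (verma_word ((D 1, n) # w)) T
    = sext (\<lambda>(A, s). of_bool (A + {#shift_letter n s#} = T)) (raise_pairs q w)
      + raise_scalar q n w T"
proof -
  define u where "u = (\<lambda>i. shift_letter n (raise_letter (w ! i)))"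
  have expand: "lookup (verma_word ((D 1, n) # w)) T
      = (\<Sum>i<length w. (of_int (ldeg (w ! i)) - 1) * lookup (verma_word (w[i := u i])) T)"
    by (simp add: verma_word_raise[OF neg] lookup_sum u_def)
  have u_deg: "ldeg (u i) = ldeg (w ! i) + 1" if "i < length w" for i
  proof -
    have "ldeg (w ! i) < 0" using neg that by simp
    then show ?thesis
      by (cases "w ! i"; cases "fst (w ! i)") (auto simp: u_def)
  qed
  consider "length w < q" | "length w = q" | "length w = Suc q"
    using assms(2) by linarith
  then show ?thesis
  proof cases
    case 1
    have "lookup (verma_word (w[i := u i])) T = 0" for i
      using keys_verma_word(3)[of T "w[i := u i]"] 1 T
        length_filter_le[of "\<lambda>b. ldeg b < 0" "w[i := u i]"]
      by (auto simp: in_keys_iff simp del: length_filter_le)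
    then show ?thesis
      using 1 by (simp add: expand raise_pairs_def raise_scalar_def)
  next
    case 2
    have summand: "lookup (verma_word (w[i := u i])) T
        = of_bool (ldeg (w ! i) < - 1) * of_bool (mset w - {#w ! i#} + {#u i#} = T)"
      if i: "i < length w" for i
    proof (cases "ldeg (w ! i) < - 1")
      case True
      have "\<forall>b\<in>set (w[i := u i]). ldeg b < 0"
        using neg True u_deg[OF i] set_update_subset_insert[of w i "u i"] by auto
      then show ?thesis
        using lookup_verma_word_leading[of "w[i := u i]" T] 2 T True i
        by (simp add: mset_update)
    next
      case False
      moreover have "ldeg (w ! i) < 0"
        using neg i by simp
      ultimately have "ldeg (u i) = 0"
        using u_deg[OF i] by simp
      then have "length (filter (\<lambda>b. ldeg b < 0) (w[i := u i])) < length (w[i := u i])"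
        using i by (intro length_filter_less[of "u i"]) (simp_all add: set_update_memI)
      then show ?thesis
        using keys_verma_word(3)[of T "w[i := u i]"] 2 T False by (auto simp: in_keys_iff)
    qed
    have "sext (\<lambda>(A, s). of_bool (A + {#shift_letter n s#} = T)) (raise_pairs q w)
        = (\<Sum>i | i < length w \<and> ldeg (w ! i) < - 1.
            (of_int (ldeg (w ! i)) - 1) * of_bool (mset w - {#w ! i#} + {#u i#} = T))"
      using 2 by (simp add: raise_pairs_def sext_sum u_def)
    also have "\<dots> = (\<Sum>i<length w. (of_int (ldeg (w ! i)) - 1)
        * (of_bool (ldeg (w ! i) < - 1) * of_bool (mset w - {#w ! i#} + {#u i#} = T)))"
      by (intro sum.mono_neutral_cong_left) auto
    also have "\<dots> = lookup (verma_word ((D 1, n) # w)) T"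
      unfolding expand by (intro sum.cong refl) (simp add: summand)
    finally show ?thesis
      using 2 by (simp add: raise_scalar_def)
  next
    case 3
    have deg1: "\<forall>b\<in>set w. ldeg b = - 1"
      using top 3 by simp
    have letter: "w ! i = (D (- 1), snd (w ! i))" if "i < length w" for i
    proof -
      have "ldeg (w ! i) = - 1" using deg1 that by simp
      then show ?thesis
        by (cases "w ! i"; cases "fst (w ! i)") auto
    qed
    have lead: "lookup (verma_word v) T = of_bool (mset v = T)"
      if "\<forall>b\<in>set v. ldeg b = - 1" "length v = q" for v
      using lookup_verma_word_leading[of v T] that T by auto
    have summand: "lookup (verma_word (w[i := u i])) T
        = \<chi> (D 0, snd (w ! i) + n) * of_bool (mset w - {#w ! i#} = T)
          - (\<Sum>l<q - i. of_bool (mset w - {#w ! i#} - {#w ! (Suc (i + l))#}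
              + {#(D (- 1), snd (w ! i) + snd (w ! (Suc (i + l))) + n)#} = T))"
      if i: "i < length w" for i
    proof -
      define a b where "a = take i w" and "b = drop (Suc i) w"
      have lb: "length b = q - i" "\<And>l. l < q - i \<Longrightarrow> b ! l = w ! (Suc (i + l))"
        using 3 i by (simp_all add: b_def)
      have la: "length a = i"
        using i by (simp add: a_def)
      have w: "w = a @ w ! i # b"
        unfolding a_def b_def by (rule id_take_nth_drop[OF i])
      have m: "mset w - {#w ! i#} = mset a + mset b"
        by (subst w) simp
      have ab: "\<forall>c\<in>set a \<union> set b. ldeg c = - 1"
        using deg1 by (auto simp: a_def b_def dest: in_set_takeD in_set_dropD)
      have ui: "u i = (D 0, snd (w ! i) + n)"
        by (subst u_def, subst letter[OF i]) simp
      have wi: "w[i := u i] = a @ u i # b"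
        using i by (simp add: upd_conv_take_nth_drop a_def b_def)
      \<comment> \<open>\<open>[d_0, d_{-1}] = - d_{-1}\<close>; together with the factor -2 from
        raising this gives the 2 in \<open>raise_pairs\<close>.\<close>
      have br: "loop_br (u i) (b ! l) = single (D (- 1), snd (w ! i) + snd (w ! (Suc (i + l))) + n) (- 1)"
        if "l < q - i" for l
      proof -
        have "Suc (i + l) < length w" using 3 that by simp
        then show ?thesis
          unfolding ui lb(2)[OF that]
          by (subst letter[of "Suc (i + l)"]) (simp_all add: loop_br_D add_ac)
      qed
      have "verma_word (a @ b @ [u i]) = cscale (\<chi> (u i)) (verma_word (a @ b))"
        using verma_word_append_nonneg[of "[u i]" "a @ b"] by (simp add: ui)
      then have "lookup (verma_word (w[i := u i])) T = \<chi> (u i) * lookup (verma_word (a @ b)) T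
          + (\<Sum>l<q - i. lookup (vext (\<lambda>c. verma_word (a @ b[l := c])) (loop_br (u i) (b ! l))) T)"
        using verma_word_move[of a "u i" b "[]"] by (simp add: wi lb(1) lookup_add lookup_sum)
      also have "lookup (verma_word (a @ b)) T = of_bool (mset w - {#w ! i#} = T)"
        unfolding m using ab la lb i 3 by (subst lead) auto
      also have "(\<Sum>l<q - i. lookup (vext (\<lambda>c. verma_word (a @ b[l := c])) (loop_br (u i) (b ! l))) T)
          = (\<Sum>l<q - i. - of_bool (mset w - {#w ! i#} - {#w ! (Suc (i + l))#}
              + {#(D (- 1), snd (w ! i) + snd (w ! (Suc (i + l))) + n)#} = T))"
      proof (intro sum.cong refl)
        fix l assume "l \<in> {..<q - i}"
        then have l: "l < q - i" by simp
        define c where "c = (D (- 1), snd (w ! i) + snd (w ! (Suc (i + l))) + n)"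
        have "\<forall>c\<in>set (a @ b[l := c]). ldeg c = - 1"
          using ab set_update_subset_insert[of b l c] by (auto simp: c_def)
        moreover have "b ! l \<in># mset b"
          using l lb(1) by simp
        then have "mset (a @ b[l := c]) = mset w - {#w ! i#} - {#w ! (Suc (i + l))#} + {#c#}"
          unfolding m using l lb by (simp add: mset_update)
        ultimately show "lookup (vext (\<lambda>c. verma_word (a @ b[l := c])) (loop_br (u i) (b ! l))) T
            = - of_bool (mset w - {#w ! i#} - {#w ! (Suc (i + l))#}
                + {#(D (- 1), snd (w ! i) + snd (w ! (Suc (i + l))) + n)#} = T)"
          using la lb(1) i 3 by (simp add: br[OF l] lead flip: c_def)
      qed
      finally show ?thesis
        by (simp add: ui sum_negf)
    qed
    have deg: "ldeg (w ! i) = - 1" if "i < length w" for i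
      using deg1 that by simp
    have "lookup (verma_word ((D 1, n) # w)) T
        = (\<Sum>i<length w. - 2 * lookup (verma_word (w[i := u i])) T)"
      unfolding expand by (intro sum.cong refl) (simp add: deg)
    also have "\<dots> = (\<Sum>i<length w. of_bool (mset w - {#w ! i#} = T) * (- 2 * \<chi> (D 0, snd (w ! i) + n)))
        + (\<Sum>i<length w. \<Sum>l<q - i. 2 * of_bool (mset w - {#w ! i#} - {#w ! (Suc (i + l))#}
              + {#(D (- 1), snd (w ! i) + snd (w ! (Suc (i + l))) + n)#} = T))"
      unfolding sum.distrib[symmetric]
      by (intro sum.cong refl) (simp add: summand algebra_simps sum_distrib_left)
    also have "\<dots> = raise_scalar q n w T
        + sext (\<lambda>(A, s). of_bool (A + {#shift_letter n s#} = T)) (raise_pairs q w)"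
      using 3 by (simp add: raise_scalar_def raise_pairs_def sext_sum)
    finally show ?thesis
      by simp
  qed
qed

end

lemma length_sorted_list_of_multiset [simp]: "length (sorted_list_of_multiset m) = size m"
  by (metis mset_sorted_list_of_multiset size_mset)

lemma diff_single_eq_iff: "b \<in># m \<Longrightarrow> b \<in># m' \<Longrightarrow> m - {#b#} = m' - {#b#} \<longleftrightarrow> m = m'"
  by (metis insert_DiffM)

section \<open>Vectors killed by all \<open>d_1 \<otimes> t^n\<close>\<close>

context loop_verma
begin

text \<open>The part of filtration degree \<open>q\<close> of \<open>d_1 \<otimes> t^n\<close>
  applied to \<open>p\<close> is evaluated first at one large \<open>n\<close>, to get
  \<open>?G = 0\<close>, which does not involve \<open>n\<close>, and then at every
  \<open>n\<close>.\<close>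

lemma raise_pairs_zero:
  assumes p: "p \<in> verma_space" and killed: "\<And>n. act (D 1, n) p = 0"
    and size_le: "\<And>m. m \<in> keys p \<Longrightarrow> size m \<le> Suc q"
    and top: "\<And>m b. m \<in> keys p \<Longrightarrow> size m = Suc q \<Longrightarrow> b \<in># m \<Longrightarrow> ldeg b = - 1"
  shows "vext (\<lambda>m. raise_pairs q (sorted_list_of_multiset m)) p = 0" (is "?G = 0")
    and "size T = q \<Longrightarrow> sext (\<lambda>m. raise_scalar q n (sorted_list_of_multiset m) T) p = 0"
proof -
  have lookup_act: "lookup (act (D 1, n) p) T
      = sext (\<lambda>(A, s). of_bool (A + {#shift_letter n s#} = T)) ?G
        + sext (\<lambda>m. raise_scalar q n (sorted_list_of_multiset m) T) p" if "size T = q" for n T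
  proof -
    have "lookup (act (D 1, n) p) T
        = sext (\<lambda>m. lookup (verma_word ((D 1, n) # sorted_list_of_multiset m)) T) p"
      by (simp add: act_def)
    also have "\<dots> = sext (\<lambda>m. sext (\<lambda>(A, s). of_bool (A + {#shift_letter n s#} = T))
          (raise_pairs q (sorted_list_of_multiset m))
        + raise_scalar q n (sorted_list_of_multiset m) T) p"
    proof (intro sext_cong refl lookup_verma_word_raise that)
      fix m assume m: "m \<in> keys p"
      show "\<forall>b\<in>set (sorted_list_of_multiset m). ldeg b < 0"
        using p m by (simp add: verma_space_def)
      show len: "length (sorted_list_of_multiset m) \<le> Suc q"
        using size_le[OF m] by simp
      show "\<forall>b\<in>set (sorted_list_of_multiset m). ldeg b = - 1"
        if "length (sorted_list_of_multiset m) = Suc q"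
        using top[OF m] that by simp
    qed
    finally show ?thesis
      by (simp add: sext_fun_add sext_vext)
  qed
  show G0: "?G = 0"
  proof (rule ccontr)
    assume "?G \<noteq> 0"
    then obtain A0 s0 where As: "(A0, s0) \<in> keys ?G"
      by (metis Poly_Mapping.keys_eq_empty all_not_in_conv surj_pair)
    have from_p: "\<exists>m\<in>keys p. (A, s) \<in> keys (raise_pairs q (sorted_list_of_multiset m))"
      if "(A, s) \<in> keys ?G" for A s
      using subsetD[OF keys_vext that] by blast
    define Z where "Z = (\<Union>m\<in>keys p. set_mset m)"
    have in_Z: "set_mset A \<subseteq> Z" if "(A, s) \<in> keys ?G" for A s
      using from_p[OF that] keys_raise_pairs(2) unfolding Z_def
      by (metis UN_upper mset_sorted_list_of_multiset set_mset_mono subset_trans)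
    \<comment> \<open>For large \<open>n\<close> a shifted letter determines the pair it comes from.\<close>
    have "finite (snd ` keys ?G)" "finite Z"
      by (simp_all add: Z_def)
    then obtain n where n: "\<And>s. s \<in> snd ` keys ?G \<Longrightarrow> shift_letter n s \<notin> Z"
      by (rule finite_fresh_shift) blast
    \<comment> \<open>Once shifted letters avoid \<open>Z\<close>, this monomial arises from the
      pair \<open>(A0, s0)\<close> alone.\<close>
    define T where "T = A0 + {#shift_letter n s0#}"
    have fresh: "shift_letter n s0 \<notin> Z"
      using n[OF image_eqI[OF _ As, of s0 snd]] by simp
    obtain m where "(A0, s0) \<in> keys (raise_pairs q (sorted_list_of_multiset m))"
      using from_p[OF As] by blast
    then have "size T = q"
      by (simp add: T_def keys_raise_pairs(1))
    have single_term: "A + {#shift_letter n s#} = T \<longleftrightarrow> (A, s) = (A0, s0)"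
      if "(A, s) \<in> keys ?G" for A s
    proof
      assume eq: "A + {#shift_letter n s#} = T"
      then have "shift_letter n s0 \<in># A + {#shift_letter n s#}"
        by (simp add: T_def)
      moreover have "shift_letter n s0 \<notin># A"
        using fresh in_Z[OF that] by auto
      ultimately have "s = s0" by auto
      then show "(A, s) = (A0, s0)"
        using eq by (simp add: T_def)
    qed (simp add: T_def)
    have "sext (\<lambda>(A, s). of_bool (A + {#shift_letter n s#} = T)) ?G
        = sext (\<lambda>x. lookup (single x 1) (A0, s0)) ?G"
    proof (rule sext_cong[OF refl])
      fix x assume "x \<in> keys ?G"
      then have "A + {#shift_letter n s#} = T \<longleftrightarrow> x = (A0, s0)" if "x = (A, s)" for A s
        using single_term[of A s] that by simp
      then show "(case x of (A, s) \<Rightarrow> of_bool (A + {#shift_letter n s#} = T))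
          = lookup (single x (1::complex)) (A0, s0)"
        by (cases x) (simp only: prod.case lookup_single when_def of_bool_def)
    qed
    also have "\<dots> = lookup ?G (A0, s0)"
      using lookup_vext[of "\<lambda>x. single x 1" ?G "(A0, s0)"] by (simp only: vext_basis)
    finally have "sext (\<lambda>(A, s). of_bool (A + {#shift_letter n s#} = T)) ?G = lookup ?G (A0, s0)" .
    \<comment> \<open>The scalar part only yields monomials contained in those of \<open>p\<close>,
      which lack the fresh letter of \<open>T\<close>.\<close>
    moreover have "raise_scalar q n (sorted_list_of_multiset m) T = 0" if "m \<in> keys p" for m
    proof -
      have "m - {#x#} \<noteq> T" for x
      proof
        assume "m - {#x#} = T"
        then have "shift_letter n s0 \<in># m"
          by (metis T_def in_diffD union_iff union_single_eq_member)
        then show False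
          using fresh that by (auto simp: Z_def)
      qed
      then show ?thesis
        by (simp add: raise_scalar_def)
    qed
    then have "sext (\<lambda>m. raise_scalar q n (sorted_list_of_multiset m) T) p = 0"
      by (rule sext_eq_zero)
    ultimately have "lookup ?G (A0, s0) = 0"
      using lookup_act[OF \<open>size T = q\<close>, of n] killed[of n] by simp
    then show False
      using As by (simp add: in_keys_iff)
  qed
  show "sext (\<lambda>m. raise_scalar q n (sorted_list_of_multiset m) T) p = 0" if "size T = q"
    using lookup_act[OF that, of n] killed[of n] by (simp add: G0)
qed

text \<open>The sum is \<open>a\<close> times the multiplicity of \<open>x\<close> in
  \<open>m\<close>, hence nonzero in characteristic 0.\<close>

lemma sum_of_bool_nth:
  assumes "a \<noteq> (0 :: complex)" "x \<in># m"
  shows "(\<Sum>i<size m. of_bool (sorted_list_of_multiset m ! i = x) * a) \<noteq> 0"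
proof -
  define w where "w = sorted_list_of_multiset m"
  have w: "x \<in> set w" "length w = size m"
    using assms(2) by (simp_all add: w_def)
  then obtain i where "i < size m" "w ! i = x"
    by (metis in_set_conv_nth)
  then have "card {i. i < size m \<and> w ! i = x} \<noteq> 0"
    by (subst card_0_eq) auto
  moreover have "(\<Sum>i<size m. of_bool (w ! i = x) * a) = of_nat (card {i. i < size m \<and> w ! i = x}) * a"
    by (simp add: sum_distrib_right[symmetric] of_bool_def sum.If_cases Int_def)
  ultimately show ?thesis
    using assms(1) by (simp add: w_def)
qed

text \<open>With \<open>r\<close> the largest size of a monomial of \<open>p\<close>,
  \<open>raise_pairs_zero\<close> at \<open>q = r\<close> shows that the monomials of that size only
  involve letters of degree -1; at \<open>q = r - 1\<close> it gives a relation for \<chi> that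
  \<open>nondeg\<close> excludes.\<close>

lemma singular_vector_scalar:
  assumes nondeg: "\<And>c :: int \<Rightarrow>\<^sub>0 complex. c \<noteq> 0 \<Longrightarrow> \<exists>n. sext (\<lambda>k. \<chi> (D 0, k + n)) c \<noteq> 0"
    and p: "p \<in> verma_space" and killed: "\<And>n. act (D 1, n) p = 0"
  shows "keys p \<subseteq> {{#}}"
proof (rule ccontr)
  assume "\<not> keys p \<subseteq> {{#}}"
  then obtain m1 where m1: "m1 \<in> keys p" "m1 \<noteq> {#}" by blast
  define r where "r = Max (size ` keys p)"
  have size_le: "size m \<le> r" if "m \<in> keys p" for m
    using that by (simp add: r_def)
  have "r \<in> size ` keys p"
    unfolding r_def using m1 by (intro Max_in) auto
  then obtain m0 where m0: "m0 \<in> keys p" "size m0 = r" by auto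
  have "r > 0"
    using size_le[OF m1(1)] m1(2) by (metis gr0I le_zero_eq size_eq_0_iff_empty)
  have neg: "ldeg b < 0" if "m \<in> keys p" "b \<in># m" for m b
    using p that by (simp add: verma_space_def)
  have top: "ldeg b = - 1" if m: "m \<in> keys p" "size m = r" and b: "b \<in># m" for m b
  proof (rule ccontr)
    assume "ldeg b \<noteq> - 1"
    with neg[OF m(1) b] have lt: "ldeg b < - 1" by simp
    \<comment> \<open>Monomials of size \<open>Suc r\<close> do not occur, so the condition on their
      letters holds vacuously.\<close>
    have G0: "vext (\<lambda>m. raise_pairs r (sorted_list_of_multiset m)) p = 0"
      by (rule raise_pairs_zero(1)[OF p killed]) (use size_le in force)+
    \<comment> \<open>\<open>raise_letter\<close> is injective, so \<open>b\<close> and then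
      \<open>m\<close> can be recovered from the pair, and no other monomial of \<open>p\<close>
      contributes to its coefficient.\<close>
    have other: "lookup (raise_pairs r (sorted_list_of_multiset m')) (m - {#b#}, raise_letter b)
        = (if m' = m then \<Sum>i<size m. of_bool (sorted_list_of_multiset m ! i = b) * (of_int (ldeg b) - 1)
           else 0)" if m': "m' \<in> keys p" for m'
    proof (cases "size m' = r")
      case True
      define w where "w = sorted_list_of_multiset m'"
      have w: "length w = r" "mset w = m'"
        using True by (simp_all add: w_def)
      have "lookup (raise_pairs r w) (m - {#b#}, raise_letter b)
          = (\<Sum>i | i < r \<and> ldeg (w ! i) < - 1. of_bool (m' - {#w ! i#} = m - {#b#} \<and> w ! i = b)
              * (of_int (ldeg b) - 1))"
        unfolding raise_pairs_def w if_P[OF refl] lookup_sum lookup_single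
        by (intro sum.cong refl) (auto simp: when_def)
      also have "\<dots> = (\<Sum>i<r. of_bool (m' = m \<and> w ! i = b) * (of_int (ldeg b) - 1))"
      proof (intro sum.mono_neutral_cong_left ballI)
        fix i assume "i \<in> {i. i < r \<and> ldeg (w ! i) < - 1}"
        then have "w ! i \<in># m'"
          using w by (metis mem_Collect_eq nth_mem_mset)
        then show "of_bool (m' - {#w ! i#} = m - {#b#} \<and> w ! i = b) * (of_int (ldeg b) - 1)
            = of_bool (m' = m \<and> w ! i = b) * (of_int (ldeg b) - 1 :: complex)"
          using b by (cases "w ! i = b") (simp_all add: diff_single_eq_iff)
      qed (use lt in auto)
      finally show ?thesis
        using m by (simp add: w_def)
    next
      case False
      then have "raise_pairs r (sorted_list_of_multiset m') = 0"
        using size_le[OF m'] by (simp add: raise_pairs_def)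
      then show ?thesis
        using False m by auto
    qed
    have "0 = sext (\<lambda>m'. lookup (raise_pairs r (sorted_list_of_multiset m')) (m - {#b#}, raise_letter b)) p"
      using arg_cong[OF G0, of "\<lambda>G. lookup G (m - {#b#}, raise_letter b)"] by simp
    also have "\<dots> = lookup p m * (\<Sum>i<size m. of_bool (sorted_list_of_multiset m ! i = b) * (of_int (ldeg b) - 1))"
      using m(1) by (simp add: sext_def other if_distrib sum.delta cong: if_cong)
    finally show False
      using sum_of_bool_nth[OF _ b, of "of_int (ldeg b) - 1"] m(1) lt
      by (auto simp: in_keys_iff)
  qed
  define q where "q = r - 1"
  have r: "r = Suc q" using \<open>r > 0\<close> by (simp add: q_def)
  obtain b0 where b0: "b0 \<in># m0"
    using m0 r by (metis size_eq_Suc_imp_elem)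
  define T where "T = m0 - {#b0#}"
  have T: "size T = q"
    using b0 m0 r by (simp add: T_def size_Diff_singleton)
  \<comment> \<open>Indexed by \<open>k\<close>, these are the coefficients of \<open>T\<close> in
    the partial derivatives of the top part of \<open>p\<close> by
    \<open>d_{-1} \<otimes> t^k\<close>.\<close>
  define c :: "int \<Rightarrow>\<^sub>0 complex" where
    "c = vext (\<lambda>m. if size m = r then \<Sum>i<r. single (snd (sorted_list_of_multiset m ! i))
        (of_bool (m - {#sorted_list_of_multiset m ! i#} = T)) else 0) p"
  have "sext (\<lambda>m. raise_scalar q n (sorted_list_of_multiset m) T) p = 0" for n
    by (rule raise_pairs_zero(2)[OF p killed _ _ T]) (use size_le top r in auto)
  moreover have "sext (\<lambda>m. raise_scalar q n (sorted_list_of_multiset m) T) p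
      = - 2 * sext (\<lambda>k. \<chi> (D 0, k + n)) c" for n
    unfolding c_def sext_vext
    by (subst sext_fun_mult[symmetric], intro sext_cong refl)
      (simp add: raise_scalar_def sext_sum sum_distrib_left r mult_ac sum_negf
        del: sum.lessThan_Suc sum_of_bool_mult_eq sum_mult_of_bool_eq)
  ultimately have "sext (\<lambda>k. \<chi> (D 0, k + n)) c = 0" for n
    by simp
  then have "c = 0"
    using nondeg by blast
  \<comment> \<open>As the letters have degree -1, the exponent \<open>snd b0\<close> determines
    \<open>b0\<close>, and then \<open>T\<close> determines \<open>m0\<close>; so this coefficient
    of \<open>c\<close> is a nonzero multiple of \<open>lookup p m0\<close>.\<close>
  have other: "lookup (if size m = r then \<Sum>i<r. single (snd (sorted_list_of_multiset m ! i))
        (of_bool (m - {#sorted_list_of_multiset m ! i#} = T)) else 0 :: int \<Rightarrow>\<^sub>0 complex) (snd b0)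
      = (if m = m0 then \<Sum>i<size m0. of_bool (sorted_list_of_multiset m0 ! i = b0) * 1 else 0)"
    if m: "m \<in> keys p" for m
  proof (cases "size m = r")
    case True
    define w where "w = sorted_list_of_multiset m"
    have w: "length w = r" "mset w = m"
      using True by (simp_all add: w_def)
    have eq: "of_bool (m - {#w ! i#} = T) * of_bool (snd (w ! i) = snd b0)
        = of_bool (m = m0 \<and> w ! i = b0) * (1::complex)" if "i < r" for i
    proof -
      have mem: "w ! i \<in># m"
        using w that by (metis nth_mem_mset)
      have letter: "b = (D (- 1), snd b)" if "ldeg b = - 1" for b
        using that by (cases b; cases "fst b") auto
      have "w ! i = b0 \<longleftrightarrow> snd (w ! i) = snd b0"
        using letter[OF top[OF m True mem]] letter[OF top[OF m0 b0]] by metis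
      moreover have "m - {#b0#} = T \<longleftrightarrow> m = m0" if "b0 \<in># m"
        using that b0 by (simp add: T_def diff_single_eq_iff)
      ultimately show ?thesis
        using mem by auto
    qed
    have "lookup (\<Sum>i<r. single (snd (w ! i)) (of_bool (m - {#w ! i#} = T))) (snd b0)
        = (\<Sum>i<r. of_bool (m = m0 \<and> w ! i = b0) * (1::complex))"
      unfolding lookup_sum
    proof (intro sum.cong refl)
      fix i assume "i \<in> {..<r}"
      then have i: "i < r" by simp
      show "lookup (single (snd (w ! i)) (of_bool (m - {#w ! i#} = T))) (snd b0)
          = of_bool (m = m0 \<and> w ! i = b0) * (1::complex)"
        unfolding eq[OF i, symmetric] lookup_single by (simp add: when_def)
    qed
    then show ?thesis
      using True m0 by (cases "m = m0") (simp_all add: w_def)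
  next
    case False
    then show ?thesis using m0 by auto
  qed
  have "lookup c (snd b0) = lookup p m0 * (\<Sum>i<size m0. of_bool (sorted_list_of_multiset m0 ! i = b0) * 1)"
    unfolding c_def lookup_vext
    using m0(1) by (subst sext_cong[OF refl other]) (simp_all add: sext_def if_distrib sum.delta cong: if_cong)
  then show False
    using sum_of_bool_nth[OF _ b0, of 1] m0(1) \<open>c = 0\<close>
    by (auto simp: in_keys_iff)
qed

lemma highest_multiple:
  assumes "keys p \<subseteq> {{#}}" "p \<noteq> 0"
  shows "lookup p {#} \<noteq> 0" "p = cscale (lookup p {#}) highest"
proof -
  have 0: "lookup p m = 0" if "m \<noteq> {#}" for m
    using assms(1) that by (auto simp: in_keys_iff)
  then show "p = cscale (lookup p {#}) highest"
    unfolding highest_def by (intro poly_mapping_eqI) (simp only: lookup_cscale lookup_single when_def, simp)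
  then show "lookup p {#} \<noteq> 0"
    using assms(2) by auto
qed

text \<open>Induction on a bound for minus the degree of the monomials: each
  \<open>d_1 \<otimes> t^n\<close> lowers it by one, and a vector killed by all of them is a
  multiple of \<open>highest\<close> by \<open>singular_vector_scalar\<close>.\<close>

lemma reach_highest_bounded:
  assumes nondeg: "\<And>c :: int \<Rightarrow>\<^sub>0 complex. c \<noteq> 0 \<Longrightarrow> \<exists>n. sext (\<lambda>k. \<chi> (D 0, k + n)) c \<noteq> 0"
  shows "p \<in> verma_space \<Longrightarrow> p \<noteq> 0 \<Longrightarrow> (\<And>m. m \<in> keys p \<Longrightarrow> - (\<Sum>b\<in>#m. ldeg b) \<le> int d)
    \<Longrightarrow> \<exists>w a. a \<noteq> 0 \<and> foldr act w p = cscale a highest"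
proof (induction d arbitrary: p)
  case (0 p)
  have "m = {#}" if "m \<in> keys p" for m
  proof (rule ccontr)
    assume "m \<noteq> {#}"
    then obtain b m' where m': "m = add_mset b m'"
      by (meson multiset_cases)
    have neg: "ldeg b < 0" if "b \<in># m" for b
      using 0(1) that \<open>m \<in> keys p\<close> by (simp add: verma_space_def)
    then have "(\<Sum>b\<in>#m'. ldeg b) \<le> (\<Sum>b\<in>#m'. 0)"
      by (intro sum_mset_mono) (simp add: m' less_imp_le)
    moreover have "ldeg b < 0"
      using neg by (simp add: m')
    ultimately show False
      using 0(3)[OF that] by (simp add: m')
  qed
  then have "keys p \<subseteq> {{#}}" by blast
  from highest_multiple[OF this 0(2)] show ?case
    by (metis foldr.simps(1) id_apply)
next
  case (Suc d p)
  show ?case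
  proof (cases "\<exists>n. act (D 1, n) p \<noteq> 0")
    case True
    then obtain n where n: "act (D 1, n) p \<noteq> 0" by blast
    have "- (\<Sum>b\<in>#m. ldeg b) \<le> int d" if "m \<in> keys (act (D 1, n) p)" for m
    proof -
      from subsetD[OF keys_vext that[unfolded act_def]]
      obtain m' where m': "m' \<in> keys p" "m \<in> keys (verma_word ((D 1, n) # sorted_list_of_multiset m'))"
        by blast
      show ?thesis
        using keys_verma_word(2)[OF m'(2)] Suc.prems(3)[OF m'(1)]
        by (simp flip: sum_mset_sum_list)
    qed
    with Suc.IH[OF act_mem n] obtain w a where "a \<noteq> 0" "foldr act w (act (D 1, n) p) = cscale a highest"
      by blast
    then show ?thesis
      by (intro exI[of _ "w @ [(D 1, n)]"] exI[of _ a]) simp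
  next
    case False
    then have "keys p \<subseteq> {{#}}"
      using Suc.prems(1) by (intro singular_vector_scalar[OF nondeg]) auto
    from highest_multiple[OF this Suc.prems(2)] show ?thesis
      by (metis foldr.simps(1) id_apply)
  qed
qed

theorem reach_highest:
  assumes nondeg: "\<And>c :: int \<Rightarrow>\<^sub>0 complex. c \<noteq> 0 \<Longrightarrow> \<exists>n. sext (\<lambda>k. \<chi> (D 0, k + n)) c \<noteq> 0"
    and p: "p \<in> verma_space" "p \<noteq> 0"
  shows "\<exists>g. free_act g p = highest"
proof -
  define d where "d = nat (Max ((\<lambda>m. - (\<Sum>b\<in>#m. ldeg b)) ` keys p))"
  have "- (\<Sum>b\<in>#m. ldeg b) \<le> int d" if "m \<in> keys p" for m
  proof -
    have "- (\<Sum>b\<in>#m. ldeg b) \<le> Max ((\<lambda>m. - (\<Sum>b\<in>#m. ldeg b)) ` keys p)"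
      using that by (intro Max_ge) auto
    then show ?thesis by (simp add: d_def)
  qed
  from reach_highest_bounded[OF nondeg p this]
  obtain w a where a: "a \<noteq> 0" "foldr act w p = cscale a highest" by blast
  have "foldr lact (map (\<lambda>b. single b 1) w) p = foldr act w p"
    by (induction w) (simp_all add: lact_single)
  with a show ?thesis
    by (intro exI[of _ "single (map (\<lambda>b. single b 1) w) (1 / a)"]) simp
qed

end

section \<open>Enveloping algebras\<close>

lemma free_alg_simps [simp]:
  "x \<otimes>\<^bsub>free_alg S\<^esub> y = x * y" "x \<oplus>\<^bsub>free_alg S\<^esub> y = x + y"
  "\<one>\<^bsub>free_alg S\<^esub> = 1" "\<zero>\<^bsub>free_alg S\<^esub> = 0"
  by (simp_all add: free_alg_def)

lemma carrier_free_alg: "carrier (free_alg S) = {f. \<forall>w\<in>keys f. set w \<subseteq> S}"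
  by (simp add: free_alg_def)

lemma carrier_free_alg_UNIV [simp]: "carrier (free_alg UNIV) = UNIV"
  by (simp add: carrier_free_alg)

lemma free_alg_closed [simp]:
  "0 \<in> carrier (free_alg S)" "1 \<in> carrier (free_alg S)"
  "f \<in> carrier (free_alg S) \<Longrightarrow> - f \<in> carrier (free_alg S)"
  "f \<in> carrier (free_alg S) \<Longrightarrow> g \<in> carrier (free_alg S) \<Longrightarrow> f * g \<in> carrier (free_alg S)"
  "f \<in> carrier (free_alg S) \<Longrightarrow> g \<in> carrier (free_alg S) \<Longrightarrow> f + g \<in> carrier (free_alg S)"
  "f \<in> carrier (free_alg S) \<Longrightarrow> g \<in> carrier (free_alg S) \<Longrightarrow> f - g \<in> carrier (free_alg S)"
  "set w \<subseteq> S \<Longrightarrow> single w a \<in> carrier (free_alg S)"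
proof -
  show "0 \<in> carrier (free_alg S)" "1 \<in> carrier (free_alg S)"
    "set w \<subseteq> S \<Longrightarrow> single w a \<in> carrier (free_alg S)"
    by (auto simp: carrier_free_alg zero_list_def)
  assume f: "f \<in> carrier (free_alg S)"
  then show "- f \<in> carrier (free_alg S)"
    by (simp add: carrier_free_alg in_keys_iff)
  assume g: "g \<in> carrier (free_alg S)"
  show "f * g \<in> carrier (free_alg S)"
    using f g Poly_Mapping.keys_mult[of f g] by (force simp: carrier_free_alg plus_list_def)
  show "f + g \<in> carrier (free_alg S)"
    using f g Poly_Mapping.keys_add[of f g] unfolding carrier_free_alg by blast
  show "f - g \<in> carrier (free_alg S)"
    using f g keys_diff[of f g] unfolding carrier_free_alg by blast
qed

lemma ring_free_alg: "ring (free_alg S)"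
proof (rule ringI)
  show "abelian_group (free_alg S)"
  proof (rule abelian_groupI)
    show "\<exists>y\<in>carrier (free_alg S). y \<oplus>\<^bsub>free_alg S\<^esub> x = \<zero>\<^bsub>free_alg S\<^esub>"
      if "x \<in> carrier (free_alg S)" for x
      using that by (intro bexI[of _ "- x"]) simp_all
  qed (simp_all add: add_ac)
  show "monoid (free_alg S)"
    by (rule monoidI) (simp_all add: mult.assoc)
qed (simp_all add: algebra_simps)

lemma minus_free_alg [simp]:
  assumes "x \<in> carrier (free_alg S)"
  shows "\<ominus>\<^bsub>free_alg S\<^esub> x = - x"
proof -
  interpret ring "free_alg S" by (rule ring_free_alg)
  show ?thesis
    using assms by (intro minus_equality) simp_all
qed

lemma ideal_free_algI:
  assumes "J \<subseteq> carrier (free_alg S)" "0 \<in> J" "\<And>f g. f \<in> J \<Longrightarrow> g \<in> J \<Longrightarrow> f + g \<in> J"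
    "\<And>f. f \<in> J \<Longrightarrow> - f \<in> J"
    "\<And>f g. f \<in> J \<Longrightarrow> g \<in> carrier (free_alg S) \<Longrightarrow> g * f \<in> J"
    "\<And>f g. f \<in> J \<Longrightarrow> g \<in> carrier (free_alg S) \<Longrightarrow> f * g \<in> J"
  shows "ideal J (free_alg S)"
proof (rule idealI[OF ring_free_alg])
  interpret ring "free_alg S" by (rule ring_free_alg)
  show "subgroup J (add_monoid (free_alg S))"
    using assms(1-4) by (intro add.subgroupI) (auto simp: subset_iff simp flip: a_inv_def)
qed (use assms(5,6) in auto)

definition lie_closed :: "loop_vir set \<Rightarrow> bool" where
  "lie_closed S \<longleftrightarrow> (\<forall>x\<in>S. \<forall>y\<in>S. x + y \<in> S \<and> loop_bracket x y \<in> S) \<and> (\<forall>a. \<forall>x\<in>S. cscale a x \<in> S)"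

lemma uea_relations_closed:
  assumes "lie_closed S"
  shows "uea_relations S \<subseteq> carrier (free_alg S)"
  using assms unfolding uea_relations_def lie_closed_def
  by auto

lemma uea_ideal_ideal: "lie_closed S \<Longrightarrow> ideal (uea_ideal S) (free_alg S)"
  unfolding uea_ideal_def by (intro ring.genideal_ideal ring_free_alg uea_relations_closed)

lemma uea_relations_subset_ideal: "lie_closed S \<Longrightarrow> uea_relations S \<subseteq> uea_ideal S"
  unfolding uea_ideal_def by (intro ring.genideal_self ring_free_alg uea_relations_closed)

lemma uea_ideal_minimal: "ideal J (free_alg S) \<Longrightarrow> uea_relations S \<subseteq> J \<Longrightarrow> uea_ideal S \<subseteq> J"
  unfolding uea_ideal_def by (rule ring.genideal_minimal[OF ring_free_alg])

lemma lie_closed_UNIV [simp]: "lie_closed UNIV"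
  by (simp add: lie_closed_def)

lemma uea_ideal_closed:
  assumes "lie_closed S"
  shows "0 \<in> uea_ideal S" "f \<in> uea_ideal S \<Longrightarrow> g \<in> uea_ideal S \<Longrightarrow> f + g \<in> uea_ideal S"
    "f \<in> uea_ideal S \<Longrightarrow> - f \<in> uea_ideal S"
    "f \<in> uea_ideal S \<Longrightarrow> g \<in> uea_ideal S \<Longrightarrow> f - g \<in> uea_ideal S"
    "f \<in> uea_ideal S \<Longrightarrow> g \<in> carrier (free_alg S) \<Longrightarrow> g * f \<in> uea_ideal S"
    "f \<in> uea_ideal S \<Longrightarrow> g \<in> carrier (free_alg S) \<Longrightarrow> f * g \<in> uea_ideal S"
    "f \<in> uea_ideal S \<Longrightarrow> f \<in> carrier (free_alg S)"
proof -
  interpret ideal "uea_ideal S" "free_alg S"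
    by (rule uea_ideal_ideal[OF assms])
  show 1: "0 \<in> uea_ideal S" "f \<in> uea_ideal S \<Longrightarrow> g \<in> uea_ideal S \<Longrightarrow> f + g \<in> uea_ideal S" for f g
    using additive_subgroup.zero_closed[OF is_additive_subgroup]
      additive_subgroup.a_closed[OF is_additive_subgroup, of f g] by simp_all
  show car: "f \<in> uea_ideal S \<Longrightarrow> f \<in> carrier (free_alg S)" for f
    by (rule a_Hcarr)
  show 2: "f \<in> uea_ideal S \<Longrightarrow> - f \<in> uea_ideal S" for f
    using additive_subgroup.a_inv_closed[OF is_additive_subgroup, of f]
      minus_free_alg[OF car] by simp
  show "f \<in> uea_ideal S \<Longrightarrow> g \<in> uea_ideal S \<Longrightarrow> f - g \<in> uea_ideal S"
    using 1(2)[of f "- g"] 2 by simp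
  show "f \<in> uea_ideal S \<Longrightarrow> g \<in> carrier (free_alg S) \<Longrightarrow> g * f \<in> uea_ideal S"
    using I_l_closed[of f g] by simp
  show "f \<in> uea_ideal S \<Longrightarrow> g \<in> carrier (free_alg S) \<Longrightarrow> f * g \<in> uea_ideal S"
    using I_r_closed[of f g] by simp
qed

text \<open>The part of the larger ideal lying over words in \<open>S\<close> is an ideal containing
  the relations of \<open>S\<close>. This makes \<open>uea_incl\<close> well defined.\<close>

lemma uea_ideal_mono:
  assumes "lie_closed S"
  shows "uea_ideal S \<subseteq> uea_ideal UNIV"
proof -
  let ?J = "{f \<in> carrier (free_alg S). f \<in> uea_ideal UNIV}"
  have "ideal ?J (free_alg S)"
    by (rule ideal_free_algI) (auto intro: uea_ideal_closed)
  moreover have "uea_relations S \<subseteq> uea_relations UNIV"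
    unfolding uea_relations_def by blast
  then have "uea_relations S \<subseteq> ?J"
    using uea_relations_closed[OF assms] uea_relations_subset_ideal[OF lie_closed_UNIV] by blast
  ultimately have "uea_ideal S \<subseteq> ?J"
    by (rule uea_ideal_minimal)
  then show ?thesis by blast
qed

section \<open>Residue classes in enveloping algebras\<close>

definition uea_class :: "loop_vir set \<Rightarrow> (loop_vir list \<Rightarrow>\<^sub>0 complex) \<Rightarrow> (loop_vir list \<Rightarrow>\<^sub>0 complex) set" where
  "uea_class S f = uea_ideal S +>\<^bsub>free_alg S\<^esub> f"

lemma uea_class_mem: "g \<in> uea_class S f \<longleftrightarrow> g - f \<in> uea_ideal S"
  by (auto simp: uea_class_def a_r_coset_def r_coset_def intro!: bexI[of _ "g - f"])

lemma uea_class_eq_iff: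
  assumes "lie_closed S"
  shows "uea_class S f = uea_class S g \<longleftrightarrow> f - g \<in> uea_ideal S"
proof
  assume "uea_class S f = uea_class S g"
  moreover have "f \<in> uea_class S f"
    by (simp add: uea_class_mem uea_ideal_closed assms)
  ultimately show "f - g \<in> uea_ideal S"
    by (simp add: uea_class_mem)
next
  assume *: "f - g \<in> uea_ideal S"
  have "h - f \<in> uea_ideal S \<longleftrightarrow> h - g \<in> uea_ideal S" for h
    using uea_ideal_closed(2)[OF assms _ *, of "h - f"] uea_ideal_closed(4)[OF assms _ *, of "h - g"]
    by auto
  then show "uea_class S f = uea_class S g"
    by (auto simp: uea_class_mem)
qed

lemma carrier_uea: "carrier (uea S) = uea_class S ` carrier (free_alg S)"
  by (auto simp: uea_def FactRing_def A_RCOSETS_def' uea_class_def)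

lemma uea_mult:
  assumes "lie_closed S" "f \<in> carrier (free_alg S)" "g \<in> carrier (free_alg S)"
  shows "uea_class S f \<otimes>\<^bsub>uea S\<^esub> uea_class S g = uea_class S (f * g)"
proof -
  interpret ideal "uea_ideal S" "free_alg S"
    by (rule uea_ideal_ideal[OF assms(1)])
  show ?thesis
    using rcoset_mult_add[OF assms(2,3)] by (simp add: uea_def FactRing_def uea_class_def)
qed

lemma uea_add:
  assumes "lie_closed S" "f \<in> carrier (free_alg S)" "g \<in> carrier (free_alg S)"
  shows "uea_class S f \<oplus>\<^bsub>uea S\<^esub> uea_class S g = uea_class S (f + g)"
proof -
  interpret ideal "uea_ideal S" "free_alg S"
    by (rule uea_ideal_ideal[OF assms(1)])
  show ?thesis
    using a_rcos_sum[OF assms(2,3)] by (simp add: uea_def FactRing_def uea_class_def)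
qed

text \<open>By \<open>uea_ideal_mono\<close> all cosets in the union coincide.\<close>

lemma uea_incl_class:
  assumes "lie_closed S"
  shows "uea_incl UNIV (uea_class S f) = uea_class UNIV f"
proof -
  have "uea_class UNIV g = uea_class UNIV f" if "g \<in> uea_class S f" for g
    using that uea_ideal_mono[OF assms] by (auto simp: uea_class_mem uea_class_eq_iff)
  moreover have "f \<in> uea_class S f"
    by (simp add: uea_class_mem uea_ideal_closed assms)
  ultimately show ?thesis
    unfolding uea_incl_def uea_class_def[symmetric] by blast
qed

lemma loop_borel_eq: "loop_borel = {x. \<forall>p\<in>keys x. basis_degree (fst p) \<ge> 0}"
proof (intro equalityI subsetI)
  fix x assume "x \<in> loop_borel"
  then obtain y z where "x = y + z" "y \<in> loop_deg 0" "z \<in> loop_plus"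
    unfolding loop_borel_def by blast
  then show "x \<in> {x. \<forall>p\<in>keys x. basis_degree (fst p) \<ge> 0}"
    using Poly_Mapping.keys_add[of y z] by (fastforce simp: loop_deg_def loop_plus_def)
next
  fix x :: loop_vir assume x: "x \<in> {x. \<forall>p\<in>keys x. basis_degree (fst p) \<ge> 0}"
  define y where "y = vext (\<lambda>p. if basis_degree (fst p) = 0 then single p 1 else 0) x"
  define z where "z = vext (\<lambda>p. if basis_degree (fst p) = 0 then 0 else single p (1::complex)) x"
  have "x = vext (\<lambda>p. single p 1) x"
    by simp
  also have "\<dots> = y + z"
    unfolding y_def z_def vext_fun_add[symmetric] by (intro vext_cong refl) simp
  finally have "x = y + z" .
  moreover have "y \<in> loop_deg 0"
    using keys_vext[of "\<lambda>p. if basis_degree (fst p) = 0 then single p 1 else 0" x]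
    unfolding y_def[symmetric] loop_deg_def by (fastforce split: if_splits)
  moreover have "z \<in> loop_plus"
    using keys_vext[of "\<lambda>p. if basis_degree (fst p) = 0 then 0 else single p (1::complex)" x] x
    unfolding z_def[symmetric] loop_plus_def by (fastforce split: if_splits)
  ultimately show "x \<in> loop_borel"
    unfolding loop_borel_def by blast
qed

lemma lie_closed_borel: "lie_closed loop_borel"
proof -
  have "basis_degree (fst p) \<ge> 0"
    if xy: "\<forall>p\<in>keys x. basis_degree (fst p) \<ge> 0" "\<forall>p\<in>keys y. basis_degree (fst p) \<ge> 0"
      and p: "p \<in> keys (loop_bracket x y)" for x y p
  proof -
    obtain a b where "a \<in> keys x" "b \<in> keys y" "p \<in> keys (loop_br a b)"
      using subsetD[OF keys_vext p[unfolded loop_bracket_vext]] keys_vext by fast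
    then show ?thesis
      using xy loop_br_deg[of p a b] by auto
  qed
  then have "loop_bracket x y \<in> loop_borel" if "x \<in> loop_borel" "y \<in> loop_borel" for x y
    using that unfolding loop_borel_eq by blast
  moreover have "x + y \<in> loop_borel" if "x \<in> loop_borel" "y \<in> loop_borel" for x y
    using that Poly_Mapping.keys_add[of x y] unfolding loop_borel_eq by blast
  moreover have "cscale a x \<in> loop_borel" if "x \<in> loop_borel" for a x
    using that keys_cscale[of a x] unfolding loop_borel_eq by blast
  ultimately show ?thesis
    unfolding lie_closed_def by blast
qed

text \<open>The annihilator of the Verma space is a two-sided ideal containing the relations, so the
  action of the free algebra descends to the enveloping algebra.\<close>

lemma uea_ideal_kills:
  fixes \<chi>
  assumes "loop_verma \<chi>"
  assumes "f \<in> uea_ideal UNIV" "p \<in> triangular_lie_basis.verma_space (\<lambda>p. basis_degree (fst p))"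
  shows "triangular_lie_basis.free_act loop_br (\<lambda>p. basis_degree (fst p)) \<chi> f p = 0"
proof -
  interpret loop_verma \<chi> by fact
  let ?J = "{f. \<forall>p\<in>verma_space. free_act f p = 0}"
  have bracket: "lact x (lact y p) - lact y (lact x p) = lact (loop_bracket x y) p"
    if "p \<in> verma_space" for x y p
    using lact_commute[OF that, of x y] by (simp add: lbr_def loop_bracket_vext)
  have "ideal ?J (free_alg UNIV)"
    by (rule ideal_free_algI) (simp_all add: free_act_linear free_act_mult)
  moreover have "uea_relations UNIV \<subseteq> ?J"
    by (auto simp: uea_relations_def free_act_linear lact_linear bracket)
  ultimately have "uea_ideal UNIV \<subseteq> ?J"
    by (rule uea_ideal_minimal)
  then show ?thesis
    using assms by blast
qed

section \<open>The Verma module\<close>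

definition weight_char :: "(loop_vir \<Rightarrow> complex) \<Rightarrow> vir_basis \<times> int \<Rightarrow> complex" where
  "weight_char \<phi> p = (if basis_degree (fst p) = 0 then \<phi> (single p 1) else 0)"

text \<open>\<phi> is a function on the whole algebra that is linear on \<open>loop_deg 0\<close>,
  where \<open>borel_character\<close> evaluates it.\<close>

locale highest_weight =
  fixes \<phi> :: "loop_vir \<Rightarrow> complex"
  assumes phi_add: "\<And>x y. x \<in> loop_deg 0 \<Longrightarrow> y \<in> loop_deg 0 \<Longrightarrow> \<phi> (x + y) = \<phi> x + \<phi> y"
    and phi_scale: "\<And>a x. x \<in> loop_deg 0 \<Longrightarrow> \<phi> (cscale a x) = a * \<phi> x"

sublocale highest_weight \<subseteq> loop_verma "weight_char \<phi>"
  by standard (simp add: weight_char_def)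

context highest_weight
begin

text \<open>Membership is proved along with the formula because additivity of \<phi> is only
  available on \<open>loop_deg 0\<close>.\<close>

lemma phi_sum:
  assumes "finite A" "\<And>p. p \<in> A \<Longrightarrow> basis_degree (fst p) = 0"
  shows "(\<Sum>p\<in>A. single p (a p)) \<in> loop_deg 0
    \<and> \<phi> (\<Sum>p\<in>A. single p (a p)) = (\<Sum>p\<in>A. a p * \<phi> (single p 1))"
  using assms
proof (induction A)
  case empty
  have "0 \<in> loop_deg 0"
    by (simp add: loop_deg_def)
  then show ?case
    using phi_scale[of 0 0] by simp
next
  case (insert p A)
  let ?y = "\<Sum>p\<in>A. single p (a p)"
  have y: "?y \<in> loop_deg 0" "\<phi> ?y = (\<Sum>p\<in>A. a p * \<phi> (single p 1))"
    using insert by auto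
  have single: "single p z \<in> loop_deg 0" for z
    using insert.prems[of p] by (cases p) (auto simp: loop_deg_def)
  have "single p (a p) + ?y \<in> loop_deg 0"
    using single[of "a p"] y(1) Poly_Mapping.keys_add[of "single p (a p)" ?y]
    unfolding loop_deg_def by blast
  then show ?case
    using insert phi_add[OF single[of "a p"] y(1)] phi_scale[OF single[of 1], of "a p"] y(2)
    by simp
qed

lemma borel_character_eq: "borel_character \<phi> x = sext (weight_char \<phi>) x"
proof -
  have "borel_character \<phi> x
      = (\<Sum>p\<in>{p \<in> keys x. basis_degree (fst p) = 0}. lookup x p * \<phi> (single p 1))"
    unfolding borel_character_def loop_component_def by (rule conjunct2[OF phi_sum]) auto
  also have "\<dots> = sext (weight_char \<phi>) x"
    unfolding sext_def by (intro sum.mono_neutral_cong_left) (auto simp: weight_char_def)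
  finally show ?thesis .
qed

abbreviation "eval_char \<equiv> free_alg_eval (borel_character \<phi>)"

lemma eval_char_eq: "eval_char f = sext (\<lambda>w. prod_list (map (sext (weight_char \<phi>)) w)) f"
  by (simp add: free_alg_eval_def sext_def[of "\<lambda>w. prod_list (map _ w)"] borel_character_eq[abs_def])

lemma free_act_borel:
  assumes "f \<in> carrier (free_alg loop_borel)"
  shows "free_act f highest = cscale (eval_char f) highest"
  using assms unfolding eval_char_eq
  by (intro free_act_highest) (auto simp: carrier_free_alg loop_borel_eq)

text \<open>Two representatives differ by an element of the ideal, which annihilates
  \<open>highest\<close>, and \<open>free_act_borel\<close> recovers the scalar from the action on
  \<open>highest\<close>; so \<open>the_elem\<close> is applied to a singleton.\<close>

lemma line_smult:
  assumes "f \<in> carrier (free_alg loop_borel)"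
  shows "uea_class loop_borel f \<odot>\<^bsub>highest_weight_line \<phi>\<^esub> z = eval_char f * z"
proof -
  have "eval_char g = eval_char f" if "g \<in> uea_class loop_borel f" for g
  proof -
    have mem: "g - f \<in> uea_ideal loop_borel"
      using that by (simp add: uea_class_mem)
    then have "g - f \<in> carrier (free_alg loop_borel)"
      by (rule uea_ideal_closed(7)[OF lie_closed_borel])
    then have "g - f + f \<in> carrier (free_alg loop_borel)"
      using assms by (rule free_alg_closed(5))
    then have g: "g \<in> carrier (free_alg loop_borel)"
      by simp
    have "free_act (g - f) highest = 0"
      using mem uea_ideal_mono[OF lie_closed_borel]
      by (intro uea_ideal_kills[OF loop_verma_axioms]) auto
    then have "cscale (eval_char g) highest = cscale (eval_char f) highest"
      by (simp add: free_act_linear free_act_borel g assms)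
    then have "lookup (cscale (eval_char g) highest) {#} = lookup (cscale (eval_char f) highest) {#}"
      by simp
    then show ?thesis
      by (simp add: highest_def)
  qed
  moreover have "f \<in> uea_class loop_borel f"
    by (simp add: uea_class_mem uea_ideal_closed lie_closed_borel)
  ultimately have "eval_char ` uea_class loop_borel f = {eval_char f}"
    by blast
  then show ?thesis
    unfolding highest_weight_line_def by simp
qed

section \<open>The tensor product by generators and relations\<close>

abbreviation "cls \<equiv> uea_class UNIV"

lemma cls_eq_iff: "cls f = cls g \<longleftrightarrow> f - g \<in> uea_ideal UNIV"
  by (rule uea_class_eq_iff) simp

abbreviation verma_frags where
  "verma_frags \<equiv> free_Abelian_group (carrier (uea UNIV) \<times> carrier (highest_weight_line \<phi>))"

definition verma_relations where
  "verma_relations = tensor_relations (uea loop_borel) (uea UNIV)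
     (\<lambda>m r. m \<otimes>\<^bsub>uea UNIV\<^esub> uea_incl UNIV r) (highest_weight_line \<phi>)"

definition verma_kernel where
  "verma_kernel = generate verma_frags verma_relations"

lemma cls_mem [simp]: "cls f \<in> carrier (uea UNIV)"
  by (simp add: carrier_uea)

lemma line_simps [simp]:
  "carrier (highest_weight_line \<phi>) = UNIV" "x \<oplus>\<^bsub>highest_weight_line \<phi>\<^esub> y = x + y"
  by (simp_all add: highest_weight_line_def)

lemma verma_relations_eq:
  "verma_relations =
     {frag_of (cls (f + g), z) - frag_of (cls f, z) - frag_of (cls g, z) | f g z. True}
   \<union> {frag_of (cls f, z + z') - frag_of (cls f, z) - frag_of (cls f, z') | f z z'. True}
   \<union> {frag_of (cls (f * g), z) - frag_of (cls f, eval_char g * z)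
        | f g z. g \<in> carrier (free_alg loop_borel)}"
  (is "_ = ?A \<union> ?B \<union> ?C")
proof -
  have 1: "{frag_of (m \<oplus>\<^bsub>uea UNIV\<^esub> m', n) - frag_of (m, n) - frag_of (m', n)
        | m m' n. m \<in> carrier (uea UNIV) \<and> m' \<in> carrier (uea UNIV)
          \<and> n \<in> carrier (highest_weight_line \<phi>)} = ?A"
    by (force simp: carrier_uea uea_add)
  have 2: "{frag_of (m, n \<oplus>\<^bsub>highest_weight_line \<phi>\<^esub> n') - frag_of (m, n) - frag_of (m, n')
        | m n n'. m \<in> carrier (uea UNIV) \<and> n \<in> carrier (highest_weight_line \<phi>)
          \<and> n' \<in> carrier (highest_weight_line \<phi>)} = ?B"
    by (force simp: carrier_uea)
  have 3: "frag_of (cls f \<otimes>\<^bsub>uea UNIV\<^esub> uea_incl UNIV (uea_class loop_borel g), z)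
        - frag_of (cls f, uea_class loop_borel g \<odot>\<^bsub>highest_weight_line \<phi>\<^esub> z)
      = frag_of (cls (f * g), z) - frag_of (cls f, eval_char g * z)"
    if "g \<in> carrier (free_alg loop_borel)" for f g z
    using that by (simp add: uea_incl_class lie_closed_borel uea_mult line_smult)
  have "{frag_of (m \<otimes>\<^bsub>uea UNIV\<^esub> uea_incl UNIV r, n) - frag_of (m, r \<odot>\<^bsub>highest_weight_line \<phi>\<^esub> n)
        | m r n. m \<in> carrier (uea UNIV) \<and> r \<in> carrier (uea loop_borel)
          \<and> n \<in> carrier (highest_weight_line \<phi>)}
      = {frag_of (cls f \<otimes>\<^bsub>uea UNIV\<^esub> uea_incl UNIV (uea_class loop_borel g), z)
        - frag_of (cls f, uea_class loop_borel g \<odot>\<^bsub>highest_weight_line \<phi>\<^esub> z)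
        | f g z. g \<in> carrier (free_alg loop_borel)}"
    unfolding carrier_uea line_simps carrier_free_alg_UNIV by blast
  also have "\<dots> = ?C"
    by (metis (lifting) 3)
  finally show ?thesis
    unfolding verma_relations_def tensor_relations_def 1 2 by simp
qed

lemma verma_relations_mem:
  "frag_of (cls (f + g), z) - frag_of (cls f, z) - frag_of (cls g, z) \<in> verma_relations"
  "frag_of (cls f, z + z') - frag_of (cls f, z) - frag_of (cls f, z') \<in> verma_relations"
  "h \<in> carrier (free_alg loop_borel) \<Longrightarrow>
    frag_of (cls (f * h), z) - frag_of (cls f, eval_char h * z) \<in> verma_relations"
  unfolding verma_relations_eq by blast+

lemma verma_relations_cases [consumes 1, case_names add_left add_right balanced]:
  assumes "r \<in> verma_relations"
  obtains f g z where "r = frag_of (cls (f + g), z) - frag_of (cls f, z) - frag_of (cls g, z)"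
  | f z z' where "r = frag_of (cls f, z + z') - frag_of (cls f, z) - frag_of (cls f, z')"
  | f h z where "h \<in> carrier (free_alg loop_borel)"
      "r = frag_of (cls (f * h), z) - frag_of (cls f, eval_char h * z)"
  using assms unfolding verma_relations_eq by blast

lemma verma_relations_carrier: "verma_relations \<subseteq> carrier verma_frags"
proof -
  have "frag_of (cls f, z) \<in> carrier verma_frags" for f z
    by simp
  moreover have "x - y \<in> carrier verma_frags"
    if "x \<in> carrier verma_frags" "y \<in> carrier verma_frags" for x y
    using that keys_diff[of x y] by auto
  ultimately show ?thesis
    unfolding verma_relations_eq by blast
qed

lemma verma_kernel_subgroup: "subgroup verma_kernel verma_frags"
  unfolding verma_kernel_def
  by (rule group.generate_is_subgroup[OF group_free_Abelian_group verma_relations_carrier])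

lemma verma_kernel_closed:
  shows "0 \<in> verma_kernel"
    and "c \<in> verma_kernel \<Longrightarrow> d \<in> verma_kernel \<Longrightarrow> c + d \<in> verma_kernel"
    and "c \<in> verma_kernel \<Longrightarrow> - c \<in> verma_kernel"
    and "c \<in> verma_kernel \<Longrightarrow> d \<in> verma_kernel \<Longrightarrow> c - d \<in> verma_kernel"
    and "c \<in> verma_relations \<Longrightarrow> c \<in> verma_kernel"
proof -
  interpret subgroup verma_kernel verma_frags
    by (rule verma_kernel_subgroup)
  show "0 \<in> verma_kernel"
    using one_closed by simp
  show add: "c \<in> verma_kernel \<Longrightarrow> d \<in> verma_kernel \<Longrightarrow> c + d \<in> verma_kernel" for c d
    using m_closed by simp
  show neg: "c \<in> verma_kernel \<Longrightarrow> - c \<in> verma_kernel" for c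
    using m_inv_closed[of c] mem_carrier[of c] by simp
  show "c \<in> verma_kernel \<Longrightarrow> d \<in> verma_kernel \<Longrightarrow> c - d \<in> verma_kernel"
    using add[of c "- d"] neg[of d] by simp
  show "c \<in> verma_relations \<Longrightarrow> c \<in> verma_kernel"
    unfolding verma_kernel_def by (rule generate.incl)
qed

lemma verma_kernel_induct [consumes 1, case_names zero relation diff]:
  assumes "c \<in> verma_kernel" and "P 0" "\<And>r. r \<in> verma_relations \<Longrightarrow> P r"
    "\<And>c d. P c \<Longrightarrow> P d \<Longrightarrow> P (c - d)"
  shows "P c"
  using assms(1) unfolding verma_kernel_def
proof (induction rule: generate.induct)
  case (inv h)
  then have "h \<in> carrier verma_frags"
    using verma_relations_carrier by blast
  then have "Poly_Mapping.keys h \<subseteq> carrier (uea UNIV) \<times> carrier (highest_weight_line \<phi>)"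
    by simp
  then show ?case
    using assms(4)[OF assms(2) assms(3)[OF inv]] by simp
next
  case (eng h1 h2)
  have "P (h1 - (0 - h2))"
    using eng assms by blast
  then show ?case by simp
qed (use assms in simp_all)

definition verma_class where
  "verma_class c = verma_kernel #>\<^bsub>verma_frags\<^esub> c"

lemma verma_class_mem: "d \<in> verma_class c \<longleftrightarrow> d - c \<in> verma_kernel"
  by (auto simp: verma_class_def r_coset_def intro!: bexI[of _ "d - c"])

lemma verma_class_eq_iff: "verma_class c = verma_class d \<longleftrightarrow> c - d \<in> verma_kernel"
proof
  assume "verma_class c = verma_class d"
  moreover have "c \<in> verma_class c"
    by (simp add: verma_class_mem verma_kernel_closed)
  ultimately show "c - d \<in> verma_kernel"
    by (simp add: verma_class_mem)
next
  assume *: "c - d \<in> verma_kernel"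
  have "h - c \<in> verma_kernel \<longleftrightarrow> h - d \<in> verma_kernel" for h
    using verma_kernel_closed(2)[OF _ *, of "h - c"] verma_kernel_closed(4)[OF _ *, of "h - d"]
    by auto
  then show "verma_class c = verma_class d"
    by (auto simp: verma_class_mem)
qed

text \<open>The tensor of the class of \<open>f\<close> with \<open>v_0\<close>; by
  \<open>carrier_verma\<close> every element of the module has this form.\<close>

definition tens :: "(loop_vir list \<Rightarrow>\<^sub>0 complex) \<Rightarrow> _" where
  "tens f = verma_class (frag_of (cls f, 1))"

lemma verma_module_eq:
  "verma_module \<phi> = \<lparr>carrier = carrier (verma_frags Mod verma_kernel),
     monoid.mult = undefined, one = undefined, zero = \<one>\<^bsub>verma_frags Mod verma_kernel\<^esub>,
     add = monoid.mult (verma_frags Mod verma_kernel),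
     smult = (\<lambda>u X. \<Union>x\<in>X. verma_class (frag_extend (\<lambda>(m, n). frag_of (u \<otimes>\<^bsub>uea UNIV\<^esub> m, n)) x))\<rparr>"
  by (simp add: verma_module_def tensor_module_def Let_def verma_class_def verma_kernel_def
      verma_relations_def)

lemma verma_add_monoid: "group (add_monoid (verma_module \<phi>))"
proof -
  have "verma_kernel \<lhd> verma_frags"
    by (rule comm_group.normal_iff_subgroup[THEN iffD2, OF abelian_free_Abelian_group
          verma_kernel_subgroup])
  then have group: "group (verma_frags Mod verma_kernel)"
    by (rule normal.factorgroup_is_group)
  define Q where "Q = verma_frags Mod verma_kernel"
  interpret Q: group Q
    unfolding Q_def by (rule group)
  have "carrier (add_monoid (verma_module \<phi>)) = carrier Q"
    "monoid.mult (add_monoid (verma_module \<phi>)) = monoid.mult Q"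
    "one (add_monoid (verma_module \<phi>)) = one Q"
    unfolding Q_def by (simp_all add: verma_module_eq)
  note eqs = this
  show ?thesis
    by (rule groupI; unfold eqs) (auto simp: Q.m_assoc)
qed

text \<open>A scalar \<open>z\<close> in the second factor crosses the tensor sign as
  \<open>single [] z\<close>, the scalar \<open>z\<close> of the free algebra; then biadditivity
  turns a difference of tensors into one tensor.\<close>

lemma verma_frag_reduce:
  assumes "c \<in> carrier verma_frags"
  shows "\<exists>f. c - frag_of (cls f, 1) \<in> verma_kernel"
proof -
  have "Poly_Mapping.keys c \<subseteq> carrier (uea UNIV) \<times> UNIV"
    using assms by simp
  then show ?thesis
  proof (rule free_Abelian_group_induct[where P = "\<lambda>c. \<exists>f. c - frag_of (cls f, 1) \<in> verma_kernel"])
    \<comment> \<open>The additivity relation for \<open>0 + 0\<close> equals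
      \<open>- frag_of (cls 0, 1)\<close>.\<close>
    show "\<exists>f. 0 - frag_of (cls f, 1) \<in> verma_kernel"
      using verma_kernel_closed(5)[OF verma_relations_mem(1)[of 0 0 1]] by (intro exI[of _ 0]) simp
  next
    fix c d
    assume "\<exists>f. c - frag_of (cls f, 1) \<in> verma_kernel" "\<exists>f. d - frag_of (cls f, 1) \<in> verma_kernel"
    then obtain f g where fg: "c - frag_of (cls f, 1) \<in> verma_kernel"
      "d - frag_of (cls g, 1) \<in> verma_kernel" by blast
    have "frag_of (cls (f - g + g), 1) - frag_of (cls (f - g), 1) - frag_of (cls g, 1) \<in> verma_kernel"
      by (intro verma_kernel_closed(5) verma_relations_mem)
    then have "(c - frag_of (cls f, 1)) - (d - frag_of (cls g, 1))
        + (frag_of (cls (f - g + g), 1) - frag_of (cls (f - g), 1) - frag_of (cls g, 1)) \<in> verma_kernel"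
      by (rule verma_kernel_closed(2)[OF verma_kernel_closed(4)[OF fg]])
    then show "\<exists>f. c - d - frag_of (cls f, 1) \<in> verma_kernel"
      by (intro exI[of _ "f - g"]) (simp add: algebra_simps)
  next
    fix a assume "a \<in> carrier (uea UNIV) \<times> (UNIV :: complex set)"
    then obtain f z where a: "a = (cls f, z)"
      by (auto simp: carrier_uea)
    have "frag_of (cls (f * single [] z), 1) - frag_of (cls f, eval_char (single [] z) * 1) \<in> verma_kernel"
      by (intro verma_kernel_closed(5) verma_relations_mem(3)) simp
    then have "- (frag_of (cls (f * single [] z), 1) - frag_of (cls f, z)) \<in> verma_kernel"
      by (intro verma_kernel_closed(3)) (simp add: eval_char_eq)
    then show "\<exists>f. frag_of a - frag_of (cls f, 1) \<in> verma_kernel"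
      by (intro exI[of _ "f * single [] z"]) (simp add: a)
  qed
qed

lemma carrier_verma: "carrier (verma_module \<phi>) = range tens"
proof -
  have "carrier (verma_module \<phi>) = verma_class ` carrier verma_frags"
    by (auto simp: verma_module_eq FactGroup_def RCOSETS_def verma_class_def)
  also have "\<dots> = range tens"
  proof (intro equalityI subsetI)
    fix X assume "X \<in> verma_class ` carrier verma_frags"
    then obtain c where "c \<in> carrier verma_frags" "X = verma_class c" by blast
    then show "X \<in> range tens"
      using verma_frag_reduce[of c] by (auto simp: tens_def verma_class_eq_iff)
  next
    fix X assume "X \<in> range tens"
    then show "X \<in> verma_class ` carrier verma_frags"
      by (auto simp: tens_def)
  qed
  finally show ?thesis .
qed

lemma verma_add: "tens f \<oplus>\<^bsub>verma_module \<phi>\<^esub> tens g = tens (f + g)"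
proof -
  have "verma_class c <#>\<^bsub>verma_frags\<^esub> verma_class d = verma_class (c + d)" for c d
  proof (intro equalityI subsetI)
    fix z assume "z \<in> verma_class c <#>\<^bsub>verma_frags\<^esub> verma_class d"
    then obtain x y where "z = x + y" "x - c \<in> verma_kernel" "y - d \<in> verma_kernel"
      by (auto simp: set_mult_def verma_class_mem)
    then show "z \<in> verma_class (c + d)"
      using verma_kernel_closed(2)[of "x - c" "y - d"] by (simp add: verma_class_mem algebra_simps)
  next
    fix z assume "z \<in> verma_class (c + d)"
    then have "z - d \<in> verma_class c" "d \<in> verma_class d"
      by (simp_all add: verma_class_mem verma_kernel_closed algebra_simps)
    moreover have "z = (z - d) \<otimes>\<^bsub>verma_frags\<^esub> d"
      by simp
    ultimately show "z \<in> verma_class c <#>\<^bsub>verma_frags\<^esub> verma_class d"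
      unfolding set_mult_def by blast
  qed
  then have "tens f \<oplus>\<^bsub>verma_module \<phi>\<^esub> tens g = verma_class (frag_of (cls f, 1) + frag_of (cls g, 1))"
    by (simp add: verma_module_eq FactGroup_def tens_def)
  also have "\<dots> = tens (f + g)"
    using verma_kernel_closed(3)[OF verma_kernel_closed(5)[OF verma_relations_mem(1)[of f g 1]]]
    by (simp add: tens_def verma_class_eq_iff algebra_simps)
  finally show ?thesis .
qed

text \<open>Left multiplication sends relations to relations, so all cosets in the union that
  defines \<open>smult\<close> coincide.\<close>

lemma verma_smult: "cls g \<odot>\<^bsub>verma_module \<phi>\<^esub> tens f = tens (g * f)"
proof -
  define S where "S = frag_extend (\<lambda>(m, n). frag_of (cls g \<otimes>\<^bsub>uea UNIV\<^esub> m, n :: complex))"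
  have S_of: "S (frag_of (cls f, z)) = frag_of (cls (g * f), z)" for f z
    by (simp add: S_def uea_mult)
  have S_diff: "S (c - d) = S c - S d" for c d
    by (simp add: S_def frag_extend_diff)
  have S_kernel: "S c \<in> verma_kernel" if "c \<in> verma_kernel" for c
    using that
  proof (induction rule: verma_kernel_induct)
    case zero
    then show ?case
      by (simp add: S_def verma_kernel_closed)
  next
    case (relation r)
    then have "S r \<in> verma_relations"
    proof (cases rule: verma_relations_cases)
      case (add_left f f' z)
      then show ?thesis
        using verma_relations_mem(1)[of "g * f" "g * f'" z] by (simp add: S_diff S_of distrib_left)
    next
      case (add_right f z z')
      then show ?thesis
        using verma_relations_mem(2)[of "g * f" z z'] by (simp add: S_diff S_of)
    next
      case (balanced f h z)
      then show ?thesis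
        using verma_relations_mem(3)[of h "g * f" z] by (simp add: S_diff S_of mult.assoc)
    qed
    then show ?case
      by (rule verma_kernel_closed(5))
  next
    case (diff c d)
    then show ?case
      by (simp add: S_diff verma_kernel_closed)
  qed
  have "verma_class (S x) = tens (g * f)" if "x \<in> tens f" for x
    using S_kernel[of "x - frag_of (cls f, 1)"] that
    by (simp add: tens_def verma_class_mem verma_class_eq_iff S_diff S_of)
  moreover have "frag_of (cls f, 1) \<in> tens f"
    by (simp add: tens_def verma_class_mem verma_kernel_closed)
  ultimately have "(\<Union>x\<in>tens f. verma_class (S x)) = tens (g * f)"
    by blast
  then show ?thesis
    by (simp add: verma_module_eq S_def)
qed

lemma verma_kernel_frag:
  "tens f = tens g \<longleftrightarrow> frag_of (cls (f - g), 1) \<in> verma_kernel"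
proof -
  have r: "frag_of (cls (f - g + g), 1) - frag_of (cls (f - g), 1) - frag_of (cls g, 1) \<in> verma_kernel"
    by (intro verma_kernel_closed(5) verma_relations_mem)
  have "frag_of (cls f, 1) - frag_of (cls g, 1) \<in> verma_kernel \<longleftrightarrow> frag_of (cls (f - g), 1) \<in> verma_kernel"
    using verma_kernel_closed(2)[OF r, of "frag_of (cls (f - g), 1)"]
      verma_kernel_closed(4)[OF _ r, of "frag_of (cls f, 1) - frag_of (cls g, 1)"]
    by auto
  then show ?thesis
    by (simp add: tens_def verma_class_eq_iff)
qed

lemma verma_zero: "\<zero>\<^bsub>verma_module \<phi>\<^esub> = tens 0"
proof -
  have "frag_of (cls 0, 1) \<in> verma_kernel"
    using verma_kernel_frag[of 0 0] by simp
  then have "verma_class 0 = tens 0"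
    using verma_kernel_closed(3) by (simp add: tens_def verma_class_eq_iff)
  moreover have "verma_class 0 = verma_kernel"
    by (auto simp: verma_class_mem)
  ultimately show ?thesis
    by (simp add: verma_module_eq FactGroup_def)
qed

end

section \<open>Comparison of the tensor product with the Verma space\<close>

context highest_weight
begin

lemma free_act_one [simp]: "free_act 1 p = p"
  using free_act_single[of 0 1 p, unfolded single_one] by (simp add: zero_list_def)

lemma lookup_highest: "lookup highest {#} = 1"
  by (simp only: highest_def lookup_single_eq)

text \<open>The comparison map on representatives, sending the tensor of \<open>X\<close> and
  \<open>z\<close> to \<open>z X v_0\<close>; by \<open>uea_ideal_kills\<close> the representative
  of \<open>X\<close> does not matter.\<close>

definition frag_value where
  "frag_value c = vext (\<lambda>(X, z). cscale z (free_act (SOME f. f \<in> X) highest)) (Poly_Mapping.map of_int c)"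

lemma frag_value_diff: "frag_value (c - d) = frag_value c - frag_value d"
proof -
  have "Poly_Mapping.map complex_of_int (c - d)
      = Poly_Mapping.map complex_of_int c - Poly_Mapping.map complex_of_int d"
    by (rule poly_mapping_eqI) (simp add: map.rep_eq lookup_minus when_def)
  then show ?thesis
    by (simp add: frag_value_def vext_diff)
qed

lemma frag_value_of: "frag_value (frag_of (cls f, z)) = cscale z (free_act f highest)"
proof -
  define g where "g = (SOME g. g \<in> cls f)"
  have "f \<in> cls f"
    by (simp add: uea_class_mem uea_ideal_closed)
  then have "g \<in> cls f"
    unfolding g_def by (rule someI)
  then have "free_act (g - f) highest = 0"
    by (intro uea_ideal_kills[OF loop_verma_axioms]) (simp_all add: uea_class_mem)
  then have "free_act g highest = free_act f highest"
    by (simp add: free_act_linear)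
  moreover have "Poly_Mapping.map of_int (frag_of (cls f, z)) = single (cls f, z) (1 :: complex)"
    by (rule poly_mapping_eqI) (simp add: map.rep_eq lookup_single when_def)
  ultimately show ?thesis
    by (simp add: frag_value_def g_def)
qed

lemma frag_value_kernel: "c \<in> verma_kernel \<Longrightarrow> frag_value c = 0"
proof (induction rule: verma_kernel_induct)
  case (relation r)
  then show ?case
  proof (cases rule: verma_relations_cases)
    case (add_left f g z)
    then show ?thesis
      by (simp add: frag_value_diff frag_value_of free_act_linear cscale_add_right)
  next
    case (add_right f z z')
    have "cscale (z + z') p = cscale z p + cscale z' p" for p :: "(vir_basis \<times> int) multiset \<Rightarrow>\<^sub>0 complex"
      by (rule poly_mapping_eqI) (simp add: lookup_add algebra_simps)
    then show ?thesis
      by (simp add: add_right frag_value_diff frag_value_of)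
  next
    case (balanced f h z)
    then show ?thesis
      by (simp add: frag_value_diff frag_value_of free_act_mult free_act_borel free_act_linear mult.commute)
  qed
qed (use frag_value_diff[of 0 0] in \<open>simp_all add: frag_value_diff\<close>)

text \<open>The annihilator of the generator of the tensor product, a left ideal of the free algebra
  by \<open>verma_null_add\<close> and \<open>verma_null_mult\<close>.\<close>

definition verma_null where
  "verma_null = {f. frag_of (cls f, 1) \<in> verma_kernel}"

lemma verma_null_iff: "tens f = tens g \<longleftrightarrow> f - g \<in> verma_null"
  by (simp add: verma_null_def verma_kernel_frag)

lemma verma_null_ideal: "i \<in> uea_ideal UNIV \<Longrightarrow> i \<in> verma_null"
proof -
  assume "i \<in> uea_ideal UNIV"
  then have "cls i = cls 0"
    by (simp add: cls_eq_iff)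
  then show ?thesis
    using verma_kernel_frag[of 0 0] by (simp add: verma_null_def)
qed

lemma verma_null_diff:
  assumes "f \<in> verma_null" "g \<in> verma_null"
  shows "f - g \<in> verma_null"
proof -
  have "tens f = tens 0" "tens g = tens 0"
    using assms by (simp_all add: verma_null_iff)
  then show ?thesis
    by (simp flip: verma_null_iff)
qed

lemma verma_null_0 [simp]: "0 \<in> verma_null"
  using verma_null_ideal uea_ideal_closed(1) by simp

lemma verma_null_add: "f \<in> verma_null \<Longrightarrow> g \<in> verma_null \<Longrightarrow> f + g \<in> verma_null"
  using verma_null_diff[of f "0 - g"] verma_null_diff[of 0 g] by simp

lemma verma_null_mult: "f \<in> verma_null \<Longrightarrow> g * f \<in> verma_null"
  using verma_smult[of g f] verma_smult[of g 0] verma_null_iff[of f 0] verma_null_iff[of "g * f" 0]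
  by simp

lemma verma_null_borel:
  assumes "h \<in> carrier (free_alg loop_borel)"
  shows "f * h - f * single [] (eval_char h) \<in> verma_null"
proof -
  let ?c = "single [] (eval_char h) :: loop_vir list \<Rightarrow>\<^sub>0 complex"
  have "frag_of (cls (f * h), 1) - frag_of (cls f, eval_char h * 1) \<in> verma_kernel"
    "frag_of (cls (f * ?c), 1) - frag_of (cls f, eval_char ?c * 1) \<in> verma_kernel"
    by (intro verma_kernel_closed(5) verma_relations_mem(3); use assms in simp)+
  from verma_kernel_closed(4)[OF this]
  have "frag_of (cls (f * h), 1) - frag_of (cls (f * ?c), 1) \<in> verma_kernel"
    by (simp add: eval_char_eq)
  then show ?thesis
    by (simp add: verma_null_iff[symmetric] tens_def verma_class_eq_iff)
qed

lemma cscale_single_mult: "cscale a f = single [] a * (f :: 'x list \<Rightarrow>\<^sub>0 complex)"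
  unfolding cscale_def mult_map_scale_conv_mult zero_list_def ..

lemma verma_null_vext: "(\<And>w. w \<in> keys f \<Longrightarrow> g w \<in> verma_null) \<Longrightarrow> vext g f \<in> verma_null"
proof -
  have "(\<Sum>w\<in>A. cscale (lookup f w) (g w)) \<in> verma_null" if "\<And>w. w \<in> A \<Longrightarrow> g w \<in> verma_null" for A
    using that
    by (induction A rule: infinite_finite_induct)
      (simp_all add: verma_null_add verma_null_mult cscale_single_mult)
  then show "(\<And>w. w \<in> keys f \<Longrightarrow> g w \<in> verma_null) \<Longrightarrow> vext g f \<in> verma_null"
    unfolding vext_def by blast
qed

lemma uea_ideal_relations:
  "single [x + y] 1 - single [x] 1 - single [y] 1 \<in> uea_ideal UNIV"
  "single [cscale a x] 1 - single [x] a \<in> uea_ideal UNIV"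
  "single [x, y] 1 - single [y, x] 1 - single [loop_bracket x y] 1 \<in> uea_ideal UNIV"
proof -
  note rel = subsetD[OF uea_relations_subset_ideal[OF lie_closed_UNIV]]
  show "single [x + y] 1 - single [x] 1 - single [y] 1 \<in> uea_ideal UNIV"
    by (rule rel, unfold uea_relations_def, rule UnI1, rule UnI1) blast
  show "single [cscale a x] 1 - single [x] a \<in> uea_ideal UNIV"
    by (rule rel, unfold uea_relations_def, rule UnI1, rule UnI2) blast
  show "single [x, y] 1 - single [y, x] 1 - single [loop_bracket x y] 1 \<in> uea_ideal UNIV"
    by (rule rel, unfold uea_relations_def, rule UnI2) blast
qed

text \<open>Letters of the free algebra are arbitrary Lie algebra elements; the linear relations
  reduce them to basis elements.\<close>

lemma letter_expand: "single [x] 1 - vext (\<lambda>b. single [single b 1] 1) x \<in> uea_ideal UNIV"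
proof -
  let ?d = "\<lambda>x. single [x] 1 - vext (\<lambda>b. single [single b 1] (1::complex)) x"
  have add: "?d (x + y) \<in> uea_ideal UNIV" if "?d x \<in> uea_ideal UNIV" "?d y \<in> uea_ideal UNIV" for x y
  proof -
    from uea_ideal_closed(2)[OF lie_closed_UNIV
        uea_ideal_closed(2)[OF lie_closed_UNIV uea_ideal_relations(1)[of x y] that(1)] that(2)]
    show ?thesis
      by (simp add: vext_add algebra_simps)
  qed
  have single: "?d (single b a) \<in> uea_ideal UNIV" for b a
    using uea_ideal_relations(2)[of a "single b 1"] by simp
  have "?d (\<Sum>b\<in>A. single b (lookup x b)) \<in> uea_ideal UNIV" for A
  proof (induction A rule: infinite_finite_induct)
    case (insert b A)
    show ?case
      unfolding sum.insert[OF insert.hyps] by (rule add[OF single insert.IH])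
  \<comment> \<open>Empty and infinite sums are 0, which is obtained here as
    \<open>single undefined 0\<close>.\<close>
  qed (use single[of undefined 0] in \<open>simp_all add: sum.infinite\<close>)
  from this[of "keys x"] show ?thesis
    by (simp only: vext_basis[of x, unfolded vext_def cscale_simps mult_1_right])
qed

lemma word_letter_expand:
  "single (u @ x # v) 1 - vext (\<lambda>b. single (u @ single b 1 # v) 1) x \<in> uea_ideal UNIV"
proof -
  have "single u 1 * (single [x] 1 - vext (\<lambda>b. single [single b 1] 1) x) * single v 1 \<in> uea_ideal UNIV"
    by (intro uea_ideal_closed(5,6) letter_expand) simp_all
  moreover have "single u 1 * vext (\<lambda>b. single [single b 1] 1) x * single v 1
      = vext (\<lambda>b. single (u @ single b 1 # v) (1::complex)) x"
    by (simp add: mult_vext[of "single u 1"] mult_vext[of _ "single v 1"] vext_vext plus_list_def)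
  ultimately show ?thesis
    by (simp add: algebra_simps mult_single plus_list_def)
qed

abbreviation embed_word :: "(vir_basis \<times> int) list \<Rightarrow> loop_vir list" where
  "embed_word w \<equiv> map (\<lambda>b. single b 1) w"

text \<open>A lift of the Verma space to the free algebra, inverse to the action on
  \<open>highest\<close> modulo \<open>verma_null\<close>.\<close>

definition embed where
  "embed p = vext (\<lambda>m. single (embed_word (sorted_list_of_multiset m)) (1::complex)) p"

lemma bracket_expand:
  "single (embed_word (u @ x # y # v)) 1 - single (embed_word (u @ y # x # v)) 1
    - vext (\<lambda>c. single (embed_word (u @ c # v)) 1) (loop_br x y) \<in> uea_ideal UNIV"
proof -
  let ?x = "single x (1::complex)" and ?y = "single y (1::complex)"
    and ?u = "single (embed_word u) (1::complex)" and ?v = "single (embed_word v) (1::complex)"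
  have "?u * (single [?x, ?y] 1 - single [?y, ?x] 1 - single [loop_bracket ?x ?y] 1) * ?v
      \<in> uea_ideal UNIV"
    by (intro uea_ideal_closed(5,6) uea_ideal_relations) simp_all
  from uea_ideal_closed(2)[OF lie_closed_UNIV this
      word_letter_expand[of "embed_word u" "loop_bracket ?x ?y" "embed_word v"]]
  show ?thesis
    by (simp add: algebra_simps mult_single plus_list_def loop_bracket_vext)
qed

text \<open>Straightening only uses rules valid modulo \<open>verma_null\<close>: swaps hold by
  \<open>bracket_expand\<close>, and trailing letters of nonnegative degree become scalars by
  \<open>verma_null_borel\<close>.\<close>

lemma embed_verma_word: "single (embed_word w) 1 - embed (verma_word w) \<in> verma_null"
proof (induction w rule: word_induct)
  case (sorted w)
  then obtain n z where w: "w = n @ z" "sorted n" "\<forall>b\<in>set n. basis_degree (fst b) < 0"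
    "\<forall>b\<in>set z. basis_degree (fst b) \<ge> 0"
    by (metis sorted_split)
  have "single (embed_word z) 1 \<in> carrier (free_alg loop_borel)"
    using w(4) by (auto simp: carrier_free_alg loop_borel_eq)
  moreover have "eval_char (single (embed_word z) 1) = char_word z"
    by (simp add: eval_char_eq char_word_def comp_def)
  ultimately have "single (embed_word n) 1 * single (embed_word z) 1
      - single (embed_word n) 1 * single [] (char_word z) \<in> verma_null"
    using verma_null_borel[of "single (embed_word z) 1" "single (embed_word n) 1"] by simp
  then show ?case
    using w by (simp add: verma_word_sorted_neg_append embed_def mult_single plus_list_def
        sorted_sort_id)
next
  case (descent u x y v)
  have expand: "embed (verma_word (u @ x # y # v)) = embed (verma_word (u @ y # x # v))
      + vext (\<lambda>c. embed (verma_word (u @ c # v))) (loop_br x y)"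
    by (simp add: embed_def verma_word_commute[of u x y v] vext_add vext_vext)
  have shorter: "vext (\<lambda>c. single (embed_word (u @ c # v)) 1 - embed (verma_word (u @ c # v)))
      (loop_br x y) \<in> verma_null"
    by (intro verma_null_vext descent.IH)
  show ?case
    using verma_null_add[OF verma_null_add[OF verma_null_ideal[OF bracket_expand[of u x y v]]
          descent.IH(1)] shorter]
    by (simp add: expand vext_fun_diff algebra_simps)
qed

text \<open>This is the spanning half: modulo \<open>verma_null\<close>, every word is a combination
  of sorted words in negative letters.\<close>

lemma embed_foldr_lact: "single w 1 - embed (foldr lact w highest) \<in> verma_null"
proof (induction w)
  case Nil
  show ?case
    unfolding foldr.simps id_apply embed_def highest_def vext_single by simp
next
  case (Cons x w)
  define p where "p = foldr lact w highest"
  have "single [x] 1 * (single w 1 - embed p) \<in> verma_null"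
    using Cons.IH unfolding p_def by (rule verma_null_mult)
  moreover have "(single [x] 1 - vext (\<lambda>b. single [single b 1] 1) x) * embed p \<in> verma_null"
    by (intro verma_null_ideal uea_ideal_closed(6) letter_expand) simp_all
  moreover have "vext (\<lambda>b. single [single b 1] 1) x * embed p - embed (lact x p) \<in> verma_null"
  proof -
    let ?s = "sorted_list_of_multiset"
    have "vext (\<lambda>b. single [single b 1] 1) x * embed p
        = vext (\<lambda>b. vext (\<lambda>m. single (embed_word (b # ?s m)) (1::complex)) p) x"
      by (simp add: mult_vext[of "vext _ _"] vext_vext embed_def plus_list_def)
    moreover have "embed (lact x p)
        = vext (\<lambda>b. vext (\<lambda>m. embed (verma_word (b # ?s m))) p) x"
      by (simp add: embed_def lact_def act_def vext_vext)
    ultimately have "vext (\<lambda>b. single [single b 1] 1) x * embed p - embed (lact x p)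
        = vext (\<lambda>b. vext (\<lambda>m. single (embed_word (b # ?s m)) 1 - embed (verma_word (b # ?s m))) p) x"
      by (simp add: vext_fun_diff)
    then show ?thesis
      by (simp only:) (intro verma_null_vext embed_verma_word)
  qed
  \<comment> \<open>The three differences telescope.\<close>
  ultimately have "single [x] 1 * (single w 1 - embed p)
      + (single [x] 1 - vext (\<lambda>b. single [single b 1] 1) x) * embed p
      + (vext (\<lambda>b. single [single b 1] 1) x * embed p - embed (lact x p)) \<in> verma_null"
    by (intro verma_null_add)
  then show ?case
    by (simp add: algebra_simps mult_single plus_list_def p_def)
qed

text \<open>\<open>frag_value\<close> shows that null elements act by 0 on \<open>highest\<close>,
  and \<open>embed\<close> gives the converse. Hence the Verma module is faithfully modelled by the
  Verma space.\<close>

theorem tens_eq_iff: "tens f = tens g \<longleftrightarrow> free_act f highest = free_act g highest"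
proof -
  have "f \<in> verma_null \<longleftrightarrow> free_act f highest = 0" for f
  proof
    assume "f \<in> verma_null"
    then have "frag_value (frag_of (cls f, 1)) = 0"
      by (intro frag_value_kernel) (simp add: verma_null_def)
    then show "free_act f highest = 0"
      by (simp add: frag_value_of)
  next
    assume *: "free_act f highest = 0"
    have "vext (\<lambda>w. single w 1 - embed (foldr lact w highest)) f \<in> verma_null"
      by (intro verma_null_vext embed_foldr_lact)
    also have "vext (\<lambda>w. single w 1 - embed (foldr lact w highest)) f = f - embed (free_act f highest)"
      by (simp add: vext_fun_diff embed_def free_act_def vext_vext)
    finally show "f \<in> verma_null"
      by (simp add: * embed_def)
  qed
  then show ?thesis
    by (simp add: verma_null_iff free_act_linear)
qed

text \<open>A nonzero vector generates \<open>highest\<close> by \<open>reach_highest\<close>, and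
  \<open>highest\<close> generates the whole module.\<close>

lemma irreducible_if_nondegenerate:
  assumes nondeg: "\<And>c :: int \<Rightarrow>\<^sub>0 complex. c \<noteq> 0 \<Longrightarrow>
    \<exists>n. sext (\<lambda>k. weight_char \<phi> (D 0, k + n)) c \<noteq> 0"
  shows "irreducible_module (uea UNIV) (verma_module \<phi>)"
  unfolding irreducible_module_def
proof (intro conjI allI impI)
  have "highest \<noteq> 0"
    using lookup_highest by auto
  then have "tens 1 \<noteq> tens 0"
    by (simp add: tens_eq_iff)
  then show "carrier (verma_module \<phi>) \<noteq> {\<zero>\<^bsub>verma_module \<phi>\<^esub>}"
    unfolding carrier_verma verma_zero by blast
  fix M assume "submodule M (uea UNIV) (verma_module \<phi>)"
  then interpret submodule M "uea UNIV" "verma_module \<phi>" .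
  have sub: "M \<subseteq> range tens"
    using subset by (simp add: carrier_verma)
  have zero: "tens 0 \<in> M"
    using one_closed by (simp add: verma_zero)
  have smult: "tens (g * f) \<in> M" if "tens f \<in> M" for f g
    using smult_closed[OF cls_mem that, of g] by (simp add: verma_smult)
  show "M = {\<zero>\<^bsub>verma_module \<phi>\<^esub>} \<or> M = carrier (verma_module \<phi>)"
  proof (cases "M \<subseteq> {tens 0}")
    case True
    then show ?thesis
      using zero by (auto simp: verma_zero)
  next
    case False
    then obtain f where f: "tens f \<in> M" "tens f \<noteq> tens 0"
      using sub by blast
    then have "free_act f highest \<noteq> 0"
      by (simp add: tens_eq_iff)
    then obtain g where g: "free_act g (free_act f highest) = highest"
      using reach_highest[OF nondeg] by (metis free_act_mem highest_mem)
    have "tens (h * (g * f)) = tens h" for h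
      by (simp add: tens_eq_iff free_act_mult g)
    then have "tens h \<in> M" for h
      using smult[OF smult[OF f(1)]] by metis
    then show ?thesis
      using sub by (auto simp: carrier_verma)
  qed
qed

text \<open>The submodule \<open>M\<close> misses \<open>v_0\<close> and contains
  \<open>(d_{-1} \<otimes> c) v_0\<close>, by \<open>highest_coefficient_vanishes\<close>; that
  vector is nonzero because its coefficients are those of \<open>c\<close>.\<close>

lemma reducible_if_degenerate:
  assumes "c \<noteq> 0" and degenerate: "\<And>n. sext (\<lambda>k. weight_char \<phi> (D 0, k + n)) c = 0"
  shows "\<not> irreducible_module (uea UNIV) (verma_module \<phi>)"
proof
  assume irr: "irreducible_module (uea UNIV) (verma_module \<phi>)"
  \<comment> \<open>the largest submodule that does not contain \<open>v\<^sub>0\<close>\<close>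
  define M where "M = {tens f | f. \<forall>g. lookup (free_act (g * f) highest) {#} = 0}"
  have M_iff: "tens f \<in> M \<longleftrightarrow> (\<forall>g. lookup (free_act (g * f) highest) {#} = 0)" for f
    unfolding M_def by (auto simp: tens_eq_iff free_act_mult)
  interpret V: group "add_monoid (verma_module \<phi>)"
    by (rule verma_add_monoid)
  have inv: "inv\<^bsub>add_monoid (verma_module \<phi>)\<^esub> tens f = tens (- f)" for f
    by (rule V.inv_equality) (simp_all add: carrier_verma verma_add verma_zero)
  have "submodule M (uea UNIV) (verma_module \<phi>)"
  proof (intro submodule.intro submodule_axioms.intro V.subgroupI)
    show "M \<subseteq> carrier (add_monoid (verma_module \<phi>))"
      by (auto simp: M_def carrier_verma)
    have "tens 0 \<in> M"
      by (simp add: M_iff)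
    then show "M \<noteq> {}" by blast
    show "inv\<^bsub>add_monoid (verma_module \<phi>)\<^esub> X \<in> M" if X: "X \<in> M" for X
    proof -
      obtain f where "X = tens f" using X by (auto simp: M_def)
      then show ?thesis
        using X by (simp add: inv M_iff free_act_linear)
    qed
    show "X \<otimes>\<^bsub>add_monoid (verma_module \<phi>)\<^esub> Y \<in> M" if X: "X \<in> M" "Y \<in> M" for X Y
    proof -
      obtain f g where "X = tens f" "Y = tens g" using X by (auto simp: M_def)
      then show ?thesis
        using X by (simp add: verma_add M_iff free_act_linear distrib_left lookup_add)
    qed
    show "u \<odot>\<^bsub>verma_module \<phi>\<^esub> X \<in> M" if X: "u \<in> carrier (uea UNIV)" "X \<in> M" for u X
    proof -
      obtain f g where "X = tens f" "u = cls g" using X by (auto simp: M_def carrier_uea)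
      then show ?thesis
        using X by (simp add: verma_smult M_iff mult.assoc[symmetric])
    qed
  qed
  then have "M = {tens 0} \<or> M = range tens"
    using irr unfolding irreducible_module_def carrier_verma verma_zero by blast
  moreover have "tens 1 \<notin> M"
  proof -
    have "lookup (free_act (1 * 1) highest) {#} \<noteq> 0"
      by (simp add: lookup_highest)
    then show ?thesis
      unfolding M_iff by blast
  qed
  moreover have "\<exists>f. tens f \<in> M \<and> tens f \<noteq> tens 0"
  proof -
    define x where "x = vext (\<lambda>j. single (D (- 1), j) (1::complex)) c"
    have act_x: "foldr act w (lact x highest) = vext (\<lambda>j. verma_word (w @ [(D (- 1), j)])) c" for w
    proof (induction w)
      case Nil
      show ?case
        by (simp add: lact_def x_def vext_vext verma_word_Nil[symmetric] act_verma_word)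
    qed (simp add: act_vext act_verma_word)
    have vanish: "lookup (foldr act w (lact x highest)) {#} = 0" for w
      unfolding act_x lookup_vext by (rule highest_coefficient_vanishes[OF degenerate])
    \<comment> \<open>The letters in \<open>v\<close> are arbitrary Lie algebra elements;
      \<open>w\<close> is kept general to absorb their basis letters one at a time.\<close>
    have vanish': "lookup (foldr act w (foldr lact v (lact x highest))) {#} = 0" for v w
    proof (induction v arbitrary: w)
      case (Cons y v)
      have foldr_act_vext: "foldr act w (vext g f) = vext (\<lambda>b. foldr act w (g b)) f"
        for g and f :: loop_vir
        by (induction w) (simp_all add: act_vext)
      have "foldr act w (act b (foldr lact v (lact x highest)))
          = foldr act (w @ [b]) (foldr lact v (lact x highest))" for b
        by simp
      then show ?case
        using Cons.IH by (simp add: lact_def[of y] foldr_act_vext del: foldr_append)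
    qed (simp add: vanish)
    have "tens (single [x] 1) \<in> M"
      using vanish'[of "[]"] by (simp add: M_iff free_act_mult) (simp add: free_act_def)
    moreover have "tens (single [x] 1) \<noteq> tens 0"
    proof
      assume "tens (single [x] 1) = tens 0"
      then have "lact x highest = 0"
        by (simp add: tens_eq_iff)
      then have "sext (\<lambda>j. lookup (verma_word [(D (- 1), j)]) {#(D (- 1), k)#}) c = 0" for k
        using act_x[of "[]"] lookup_vext[of "\<lambda>j. verma_word [(D (- 1), j)]" c "{#(D (- 1), k)#}"]
        by simp
      moreover have "lookup (verma_word [(D (- 1), j)]) {#(D (- 1), k)#} = lookup (single j 1) k" for j k
        by (subst lookup_verma_word_leading) (simp_all add: lookup_single when_def)
      ultimately have "lookup (vext (\<lambda>j. single j 1) c) k = 0" for k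
        unfolding lookup_vext by simp
      then show False
        using \<open>c \<noteq> 0\<close> by (auto intro: poly_mapping_eqI)
    qed
    ultimately show ?thesis by blast
  qed
  ultimately show False by blast
qed

section \<open>Laurent polynomials and polynomials with nonzero constant term\<close>

lemma phi_D0:
  "\<phi> (loop_tensor (vir_d 0) f) = sext (\<lambda>k. weight_char \<phi> (D 0, k)) f"
proof -
  have "loop_tensor (vir_d 0) f = (\<Sum>p\<in>Pair (D 0) ` keys f. single p (lookup f (snd p)))"
    by (simp add: loop_tensor_def vir_d_def sum.reindex inj_on_def)
  moreover have "\<phi> (\<Sum>p\<in>Pair (D 0) ` keys f. single p (lookup f (snd p)))
      = (\<Sum>p\<in>Pair (D 0) ` keys f. lookup f (snd p) * \<phi> (single p 1))"
    by (rule conjunct2[OF phi_sum]) auto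
  ultimately show ?thesis
    by (simp add: sum.reindex inj_on_def sext_def weight_char_def)
qed

lemma sext_t_pow_mult:
  "sext \<psi> (t_pow n * f) = sext (\<lambda>k. \<psi> (k + n)) f"
  unfolding t_pow_def mult_vext[of "single n 1"] by (simp add: sext_vext add.commute)

lemma lookup_laurent_of_poly:
  "lookup (laurent_of_poly P) k = (if k < 0 then 0 else coeff P (nat k))"
proof -
  have "lookup (laurent_of_poly P) k = (\<Sum>i\<le>degree P. if i = nat k \<and> k \<ge> 0 then coeff P i else 0)"
    unfolding laurent_of_poly_def lookup_sum
    by (intro sum.cong refl) (auto simp: lookup_single when_def)
  then show ?thesis
    by (auto simp: coeff_eq_0)
qed

text \<open>Multiplying by \<open>t_pow (- a)\<close>, where \<open>a\<close> is the least exponent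
  in \<open>c\<close>, moves the lowest nonzero coefficient to the constant term.\<close>

lemma laurent_unit_multiple:
  assumes "c \<noteq> (0 :: laurent)"
  obtains P n where "coeff P 0 \<noteq> 0" "laurent_of_poly P = t_pow n * c"
proof -
  define a where "a = Min (keys c)"
  have ne: "keys c \<noteq> {}"
    using assms by simp
  define P where "P = (\<Sum>k\<in>keys c. monom (lookup c k) (nat (k - a)))"
  have le: "a \<le> k" if "k \<in> keys c" for k
    using that by (simp add: a_def)
  have coeff: "coeff P i = lookup c (a + int i)" for i
  proof -
    have "coeff P i = (\<Sum>k\<in>keys c. if k = a + int i then lookup c k else 0)"
      unfolding P_def coeff_sum by (intro sum.cong refl) (use le in force)
    then show ?thesis
      by (auto simp: in_keys_iff)
  qed
  have "a \<in> keys c"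
    using ne by (simp add: a_def)
  then have "coeff P 0 \<noteq> 0"
    by (simp add: coeff in_keys_iff)
  moreover have "laurent_of_poly P = t_pow (- a) * c"
  proof (rule poly_mapping_eqI)
    fix k
    have "lookup (t_pow (- a) * c) k = sext (\<lambda>j. lookup (single j 1) (k + a)) c"
      unfolding t_pow_def mult_vext[of "single (- a) 1"] vext_single lookup_cscale lookup_vext
      by (simp, intro sext_cong refl) (auto simp: lookup_single when_def)
    also have "\<dots> = lookup c (k + a)"
      using lookup_vext[of "\<lambda>j. single j 1" c "k + a"] by (simp only: vext_basis)
    also have "\<dots> = lookup (laurent_of_poly P) k"
      using le[of "k + a"]
      by (cases "lookup c (k + a) = 0") (simp_all add: lookup_laurent_of_poly coeff add.commute in_keys_iff)
    finally show "lookup (laurent_of_poly P) k = lookup (t_pow (- a) * c) k" ..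
  qed
  ultimately show ?thesis
    using that by blast
qed

end

theorem theorem6p5:
  fixes \<phi> :: "loop_vir \<Rightarrow> complex"
  assumes phi_add: "\<And>x y. x \<in> loop_deg 0 \<Longrightarrow> y \<in> loop_deg 0 \<Longrightarrow> \<phi> (x + y) = \<phi> x + \<phi> y"
    and phi_scale: "\<And>a x. x \<in> loop_deg 0 \<Longrightarrow> \<phi> (cscale a x) = a * \<phi> x"
  shows "\<not> irreducible_module (uea UNIV) (verma_module \<phi>) \<longleftrightarrow>
    (\<exists>P :: complex poly. Polynomial.coeff P 0 \<noteq> 0 \<and>
      (\<forall>k :: int. \<phi> (loop_tensor (vir_d 0) (t_pow k * laurent_of_poly P)) = 0))"
proof -
  interpret highest_weight \<phi>
    by standard (fact phi_add phi_scale)+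
  let ?B = "\<lambda>c n. sext (\<lambda>k. weight_char \<phi> (D 0, k + n)) c"
  show ?thesis
  proof
    assume "\<not> irreducible_module (uea UNIV) (verma_module \<phi>)"
    then obtain c where c: "c \<noteq> 0" "\<And>n. ?B c n = 0"
      using irreducible_if_nondegenerate by blast
    obtain P m where P: "coeff P 0 \<noteq> 0" "laurent_of_poly P = t_pow m * c"
      using laurent_unit_multiple[OF c(1)] .
    \<comment> \<open>The shift by \<open>m\<close> is harmless, as \<open>?B c\<close> vanishes at
      every integer.\<close>
    have "\<phi> (loop_tensor (vir_d 0) (t_pow k * laurent_of_poly P)) = ?B c (m + k)" for k
      by (simp add: phi_D0 P(2) sext_t_pow_mult add_ac)
    then show "\<exists>P :: complex poly. Polynomial.coeff P 0 \<noteq> 0 \<and>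
      (\<forall>k :: int. \<phi> (loop_tensor (vir_d 0) (t_pow k * laurent_of_poly P)) = 0)"
      using P(1) c(2) by auto
  next
    assume "\<exists>P :: complex poly. Polynomial.coeff P 0 \<noteq> 0 \<and>
      (\<forall>k :: int. \<phi> (loop_tensor (vir_d 0) (t_pow k * laurent_of_poly P)) = 0)"
    then obtain P where P: "coeff P 0 \<noteq> 0"
      "\<And>k. \<phi> (loop_tensor (vir_d 0) (t_pow k * laurent_of_poly P)) = 0" by blast
    have "lookup (laurent_of_poly P) 0 \<noteq> 0"
      using P(1) by (simp add: lookup_laurent_of_poly)
    then have "laurent_of_poly P \<noteq> 0" by auto
    moreover have "?B (laurent_of_poly P) n = 0" for n
      using P(2)[of n] by (simp add: phi_D0 sext_t_pow_mult)
    ultimately show "\<not> irreducible_module (uea UNIV) (verma_module \<phi>)"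
      by (rule reducible_if_degenerate)
  qed
qed

end
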